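(* Let $\mathcal{H}_1,\mathcal{H}_2,\mathcal{H}_3,\mathcal{H}_4$ be separable Hilbert spaces, $r\in\mathbb{N}$, $M\in L_2(\mathcal{H}_1,\mathcal{H}_4)$, $B\in\mathcal{B}(\mathcal{H}_3,\mathcal{H}_4)$, $C\in\mathcal{B}(\mathcal{H}_1,\mathcal{H}_2)$, and let $\mathcal{X}_r$ be the set defined in the context. Put $K:=P_{\overline{\operatorname{ran}B}}MP_{(\ker C)^\perp}$ and let $Y=(K)_r=\sum_{i=1}^{s}\lambda_i\,f_i\otimes e_i$ be any rank-$r$ truncated SVD of $K$, where $s=\min(r,\dim\operatorname{ran}K)$, $\lambda_1\ge\dots\ge\lambda_s>0$, and $(e_i)_{i\le s}\subset\mathcal{H}_1$, $(f_i)_{i\le s}\subset\mathcal{H}_4$ are orthonormal. (It is not assumed that $\operatorname{ran}Y\subset\operatorname{dom}(B^\dagger)$.) For $n\in\mathbb{N}$ and $i\le s$ choose $f_i^n\in\operatorname{ran}B$ with $\|f_i-f_i^m\|<1/n$ whenever $m\ge n$ (such choices exist), and set $Y^{(n)}:=\sum_{i=1}^s\lambda_i\,f_i^n\otimes e_i$ and $\hat X^{(n)}:=B^\dagger Y^{(n)}C^\dagger$. Then each $\hat X^{(n)}$ is a well-defined element of $\mathcal{X}_r$ with $\operatorname{dom}(\hat X^{(n)})=\operatorname{dom}(C^\dagger)$, it satisfies $\hat X^{(n)}=P_{(\ker B)^\perp}\hat X^{(n)}P_{\overline{\operatorname{ran}C}}$ on $\operatorname{dom}(C^\dagger)$, and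 $$\|M-B\hat X^{(n)}C\|_{L_2}\to\inf\{\|M-BXC\|_{L_2}:\ X\in\mathcal{X}_r\}\quad\text{as }n\to\infty.$$
   Context: All Hilbert spaces are over a common field $\mathbb{R}$ or $\mathbb{C}$ and may be finite- or infinite-dimensional. A linear operator $T:\mathcal{H}\to\mathcal{K}$ is a linear map defined on a linear subspace $\operatorname{dom}(T)\subset\mathcal{H}$ (not necessarily all of $\mathcal{H}$), possibly unbounded; $\operatorname{dom}(TS)=S^{-1}(\operatorname{dom}T)$. $\mathcal{B}(\mathcal{H},\mathcal{K})$ denotes the bounded everywhere-defined operators, $L_2(\mathcal{H},\mathcal{K})$ the Hilbert--Schmidt operators with norm $\|\cdot\|_{L_2}$. $P_V$ is the orthogonal projector onto a closed subspace $V$, and $(f\otimes e)(h)=\langle h,e\rangle f$. Moore--Penrose inverse: for $T\in\mathcal{B}(\mathcal{H},\mathcal{K})$, $\operatorname{dom}(T^\dagger)=\operatorname{ran}T\oplus(\operatorname{ran}T)^\perp$ and $T^\dagger(h+k)=(T|_{(\ker T)^\perp})^{-1}h$ for $h\in\operatorname{ran}T$, $k\in(\operatorname{ran}T)^\perp$. A compact operator $T$ has an SVD $T=\sum_i\sigma_i f_i\otimes e_i$ with nonincreasing singular values and orthonormal systems $(e_i),(f_i)$; a rank-$r$ truncated SVD $(T)_r$ keeps the first $r$ terms (all terms if there are fewer than $r$). $\mathcal{X}_r=\{X:\mathcal{H}_2\to\mathcal{H}_3 \text{ linear}:\ \operatorname{dom}(X)\supset\operatorname{dom}(C^\dagger),\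 \dim\operatorname{ran}X\le r,\ BXC\in L_2(\mathcal{H}_1,\mathcal{H}_4)\}.$ *)

theory Defs
  imports "HOL-Analysis.Analysis" "HOL-Library.Extended_Nat"
begin


text \<open>
  A common scalar field for real and complex Hilbert spaces. Up to isomorphism the class has
  exactly the two members \<open>real\<close> and \<open>complex\<close>, with their usual absolute value and
  conjugation: see the two instances and lemma \<open>rc_field_real_or_complex\<close> below.
\<close>

class rc_field = real_normed_field +
  fixes conjg :: "'a \<Rightarrow> 'a"
  assumes conjg_add: "conjg (x + y) = conjg x + conjg y"
    and conjg_scaleR: "x * conjg x = scaleR ((norm x)\<^sup>2) 1"

instantiation real :: rc_field
begin
definition conjg_real :: "real \<Rightarrow> real" where "conjg_real x = x"
instance by standard (auto simp: conjg_real_def power2_eq_square)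
end

instantiation complex :: rc_field
begin
definition conjg_complex :: "complex \<Rightarrow> complex" where "conjg_complex = cnj"
instance by standard (simp_all add: conjg_complex_def scaleR_conv_of_real complex_norm_square[symmetric])
end

lemma mult_conjg: "x * conjg x = of_real ((norm x)\<^sup>2)" for x :: "'k::rc_field"
  by (simp add: conjg_scaleR of_real_def)

lemma rc_conjg_of_real: "conjg (of_real a) = (of_real a :: 'k::rc_field)"
proof (cases "a = 0")
  case True
  have "conjg (0::'k) + conjg 0 = conjg 0"
    by (metis add_0 conjg_add)
  then show ?thesis using True by simp
next
  case False
  have "of_real a * conjg (of_real a) = (of_real a * of_real a :: 'k)"
    by (subst mult_conjg) (simp add: power2_eq_square)
  then show ?thesis using False by simp
qed

lemma rc_conjg_mult: "conjg (x * y) = conjg x * conjg (y :: 'k::rc_field)"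
proof (cases "x * y = 0")
  case True
  then show ?thesis using rc_conjg_of_real[of 0, where 'k = 'k] by auto
next
  case False
  have "(x * y) * conjg (x * y) = of_real ((norm x)\<^sup>2) * of_real ((norm y)\<^sup>2)"
    by (subst mult_conjg) (simp add: norm_mult power_mult_distrib)
  also have "\<dots> = (x * y) * (conjg x * conjg y)"
    by (simp only: mult_conjg[symmetric] ac_simps)
  finally show ?thesis using False by simp
qed

lemma rc_conjg_conjg: "conjg (conjg x) = (x :: 'k::rc_field)"
proof (cases "x = 0")
  case True
  then show ?thesis using rc_conjg_of_real[of 0, where 'k = 'k] by simp
next
  case False
  have "conjg x * conjg (conjg x) = conjg (x * conjg x)" by (simp add: rc_conjg_mult)
  also have "\<dots> = conjg x * x" using mult_conjg[of x] rc_conjg_of_real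
    by (metis mult.commute)
  finally show ?thesis using False mult_conjg[of x] by (metis mult_cancel_left mult_eq_0_iff
    norm_eq_zero of_real_eq_0_iff power_eq_0_iff)
qed

lemma rc_trace_real: "x + conjg x \<in> range (of_real :: real \<Rightarrow> 'k::rc_field)"
proof -
  have "(1 + x) * conjg (1 + x) = 1 + (x + conjg x) + x * conjg x"
    using rc_conjg_of_real[of 1, where 'k = 'k] by (simp add: conjg_add algebra_simps)
  then have "x + conjg x = of_real ((norm (1 + x))\<^sup>2 - 1 - (norm x)\<^sup>2)"
    by (simp add: mult_conjg)
  then show ?thesis by blast
qed

lemma rc_fixed_real: "conjg x = x \<Longrightarrow> x \<in> range (of_real :: real \<Rightarrow> 'k::rc_field)"
proof -
  assume "conjg x = x"
  then obtain t where "x + x = of_real t" using rc_trace_real[of x] by auto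
  then have "x = of_real (t / 2)" by (simp add: field_simps flip: mult_2)
  then show ?thesis by blast
qed

lemma rc_field_real_or_complex:
  "bij (of_real :: real \<Rightarrow> 'k::rc_field) \<or>
   (\<exists>\<psi> :: complex \<Rightarrow> 'k. bij \<psi> \<and> (\<forall>z w. \<psi> (z + w) = \<psi> z + \<psi> w) \<and> (\<forall>z w. \<psi> (z * w) = \<psi> z * \<psi> w) \<and>
      (\<forall>a. \<psi> (of_real a) = of_real a) \<and> (\<forall>z. norm (\<psi> z) = norm z) \<and> (\<forall>z. conjg (\<psi> z) = \<psi> (cnj z)))"
proof (cases "range (of_real :: real \<Rightarrow> 'k) = UNIV")
  case True
  then show ?thesis by (simp add: bij_def inj_of_real)
next
  case False
  then obtain x :: 'k where x: "x \<notin> range of_real" by blast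
  define y where "y = x - conjg x"
  have cy: "conjg y = - y"
  proof -
    have "conjg y + conjg (conjg x) = conjg x" by (simp add: y_def conjg_add[symmetric])
    then show ?thesis by (simp add: rc_conjg_conjg y_def algebra_simps)
  qed
  have y0: "y \<noteq> 0" using x rc_fixed_real[of x] by (auto simp: y_def)
  define j where "j = y / of_real (norm y)"
  have nj: "norm j = 1" using y0 by (simp add: j_def norm_divide)
  have j0: "j \<noteq> 0" using nj by auto
  have cj: "conjg j = - j"
  proof -
    have "j = y * of_real (1 / norm y)" by (simp add: j_def)
    then show ?thesis by (metis cy mult_minus_left rc_conjg_mult rc_conjg_of_real)
  qed
  have jj: "j * j = -1" using mult_conjg[of j] by (simp add: cj nj minus_equation_iff)
  define \<psi> :: "complex \<Rightarrow> 'k" where "\<psi> z = of_real (Re z) + of_real (Im z) * j" for z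
  have add: "\<psi> (z + w) = \<psi> z + \<psi> w" for z w by (simp add: \<psi>_def algebra_simps)
  have mul: "\<psi> (z * w) = \<psi> z * \<psi> w" for z w
  proof -
    have "\<psi> z * \<psi> w = of_real (Re z) * of_real (Re w) + of_real (Im z) * of_real (Im w) * (j * j)
       + (of_real (Re z) * of_real (Im w) + of_real (Im z) * of_real (Re w)) * j"
      by (simp add: \<psi>_def algebra_simps)
    also have "\<dots> = \<psi> (z * w)" by (simp only: jj) (simp add: \<psi>_def algebra_simps)
    finally show ?thesis by simp
  qed
  have re: "\<psi> (of_real a) = of_real a" for a by (simp add: \<psi>_def)
  have cnj: "conjg (\<psi> z) = \<psi> (cnj z)" for z
    by (simp add: \<psi>_def conjg_add rc_conjg_mult rc_conjg_of_real cj)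
  have nrm: "norm (\<psi> z) = norm z" for z
  proof -
    have "of_real ((norm (\<psi> z))\<^sup>2) = \<psi> (z * cnj z)" by (simp only: mult_conjg[symmetric] cnj mul)
    also have "\<dots> = of_real ((norm z)\<^sup>2)" by (simp only: complex_norm_square[symmetric] re)
    finally have "(norm (\<psi> z))\<^sup>2 = (norm z)\<^sup>2" by (simp only: of_real_eq_iff)
    then show ?thesis by simp
  qed
  have inj: "inj \<psi>"
  proof (rule injI)
    fix z w assume "\<psi> z = \<psi> w"
    then have "\<psi> (z - w) = 0" using add[of "z - w" w] by simp
    then show "z = w" using nrm[of "z - w"] by simp
  qed
  have surj: "\<exists>w. z = \<psi> w" for z
  proof -
    obtain a where a: "z + conjg z = of_real a" using rc_trace_real by blast
    define v where "v = z - conjg z"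
    have cv: "conjg v = - v"
    proof -
      have "conjg v + conjg (conjg z) = conjg z" by (simp add: v_def conjg_add[symmetric])
      then show ?thesis by (simp add: rc_conjg_conjg v_def algebra_simps)
    qed
    have "conjg (v * j) = v * j" by (simp add: rc_conjg_mult cv cj)
    then obtain b where b: "v * j = of_real b" using rc_fixed_real by blast
    have "v = - (v * j) * j" using jj by (simp add: mult.assoc)
    then have v: "v = of_real (- b) * j" by (simp add: b)
    have "2 * z = of_real a + v" using a by (simp add: v_def algebra_simps mult_2 flip: a)
    then have "z = of_real (a / 2) + of_real (- b / 2) * j" by (simp add: v field_simps)
    then have "z = \<psi> (Complex (a / 2) (- b / 2))" by (simp add: \<psi>_def)
    then show ?thesis ..
  qed
  have "bij \<psi>" using inj surj by (auto simp: bij_def surj_def)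
  then show ?thesis using add mul re nrm cnj by blast
qed



text \<open>
  The points of the space are the elements of a Banach space type, whose norm is required to be
  the one given by the inner product. Separability is added as a sort constraint
  (\<open>second_countable_topology\<close>) where it is assumed.
\<close>

record ('k, 'a) hilbert =
  scl :: "'k \<Rightarrow> 'a \<Rightarrow> 'a"
  ip :: "'a \<Rightarrow> 'a \<Rightarrow> 'k"

locale hilbert_space = vector_space "scl H"
  for H :: "('k::rc_field, 'a::banach) hilbert" +
  assumes scl_of_real: "scl H (of_real a) x = a *\<^sub>R x"
    and ip_add_left: "ip H (x + y) z = ip H x z + ip H y z"
    and ip_scl_left: "ip H (scl H c x) y = c * ip H x y"
    and ip_conjg: "ip H y x = conjg (ip H x y)"
    and ip_norm: "ip H x x = of_real ((norm x)\<^sup>2)"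

lemma hilbert_space_real:
  "hilbert_space \<lparr>scl = scaleR, ip = (inner :: 'a::{real_inner, banach} \<Rightarrow> 'a \<Rightarrow> real)\<rparr>"
  by unfold_locales
    (simp_all add: algebra_simps inner_add_left inner_commute conjg_real_def power2_norm_eq_inner)

lemma hilbert_space_complex: "hilbert_space \<lparr>scl = (*), ip = (\<lambda>x y. x * cnj y)\<rparr>"
  by unfold_locales
    (simp_all add: algebra_simps conjg_complex_def scaleR_conv_of_real complex_norm_square[symmetric])

definition ocomp :: "('k::rc_field, 'a) hilbert \<Rightarrow> 'a set \<Rightarrow> 'a set" where
  "ocomp H V = {x. \<forall>v\<in>V. ip H x v = 0}"

definition proj :: "('k::rc_field, 'a::banach) hilbert \<Rightarrow> 'a set \<Rightarrow> 'a \<Rightarrow> 'a" where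
  "proj H V x = (THE p. p \<in> V \<and> x - p \<in> ocomp H V)"

definition orthonormal_on :: "('k::rc_field, 'a) hilbert \<Rightarrow> 'i set \<Rightarrow> ('i \<Rightarrow> 'a) \<Rightarrow> bool" where
  "orthonormal_on H I e \<longleftrightarrow> (\<forall>i\<in>I. \<forall>j\<in>I. ip H (e i) (e j) = (if i = j then 1 else 0))"

definition is_onb :: "('k::rc_field, 'a::banach) hilbert \<Rightarrow> 'a set \<Rightarrow> bool" where
  "is_onb H E \<longleftrightarrow> orthonormal_on H E (\<lambda>x. x) \<and> closure (module.span (scl H) E) = UNIV"

text \<open>
  The library's \<open>dim\<close> is \<open>0\<close> on infinite-dimensional subspaces, hence the case distinction.
\<close>

definition edim :: "('k::rc_field, 'a::banach) hilbert \<Rightarrow> 'a set \<Rightarrow> enat" where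
  "edim H V = (if \<exists>b. finite b \<and> V \<subseteq> module.span (scl H) b
     then enat (vector_space.dim (scl H) V) else \<infinity>)"



definition bounded_op ::
  "('k::rc_field, 'a::banach) hilbert \<Rightarrow> ('k, 'b::banach) hilbert \<Rightarrow> ('a \<Rightarrow> 'b) set" where
  "bounded_op H K =
     {T. Vector_Spaces.linear (scl H) (scl K) T \<and> (\<exists>c. \<forall>x. norm (T x) \<le> c * norm x)}"

definition hilbert_schmidt ::
  "('k::rc_field, 'a::banach) hilbert \<Rightarrow> ('k, 'b::banach) hilbert \<Rightarrow> ('a \<Rightarrow> 'b) set" where
  "hilbert_schmidt H K =
     {T \<in> bounded_op H K. \<exists>E. is_onb H E \<and> (\<lambda>e. (norm (T e))\<^sup>2) summable_on E}"

text \<open>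
  The value does not depend on the orthonormal basis; it is meaningful for Hilbert--Schmidt
  operators only.
\<close>

definition hs_norm :: "('k::rc_field, 'a::banach) hilbert \<Rightarrow> ('a \<Rightarrow> 'b::banach) \<Rightarrow> real" where
  "hs_norm H T = sqrt (\<Sum>\<^sub>\<infinity>e\<in>(SOME E. is_onb H E). (norm (T e))\<^sup>2)"

text \<open>
  Operators that need not be everywhere defined are partial functions: \<open>dom T\<close> is the domain,
  \<open>ran T\<close> the range, and \<open>T \<circ>\<^sub>m S\<close> has the domain of all \<open>x \<in> dom S\<close> whose image lies in
  \<open>dom T\<close>. Everywhere defined operators are tot functions, regarded as partial ones by
  \<open>tot\<close>.
\<close>

abbreviation tot :: "('a \<Rightarrow> 'b) \<Rightarrow> 'a \<rightharpoonup> 'b" where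
  "tot T \<equiv> (\<lambda>x. Some (T x))"

definition linear_operator ::
  "('k::rc_field, 'a::banach) hilbert \<Rightarrow> ('k, 'b::banach) hilbert \<Rightarrow> ('a \<rightharpoonup> 'b) \<Rightarrow> bool" where
  "linear_operator H K T \<longleftrightarrow> module.subspace (scl H) (dom T) \<and>
     (\<forall>x\<in>dom T. \<forall>y\<in>dom T. the (T (x + y)) = the (T x) + the (T y)) \<and>
     (\<forall>c. \<forall>x\<in>dom T. the (T (scl H c x)) = scl K c (the (T x)))"

abbreviation kern :: "('a \<Rightarrow> 'b::zero) \<Rightarrow> 'a set" where
  "kern T \<equiv> {x. T x = 0}"

definition mp_inverse ::
  "('k::rc_field, 'a::banach) hilbert \<Rightarrow> ('k, 'b::banach) hilbert \<Rightarrow> ('a \<Rightarrow> 'b) \<Rightarrow> 'b \<rightharpoonup> 'a" where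
  "mp_inverse H K T y =
     (if \<exists>h\<in>range T. \<exists>k\<in>ocomp K (range T). y = h + k
      then Some (THE x. \<exists>h\<in>range T. \<exists>k\<in>ocomp K (range T). y = h + k \<and>
                         x = inv_into (ocomp H (kern T)) T h)
      else None)"

definition tensor ::
  "('k::rc_field, 'a::banach) hilbert \<Rightarrow> ('k, 'b::banach) hilbert \<Rightarrow> 'b \<Rightarrow> 'a \<Rightarrow> 'a \<Rightarrow> 'b" where
  "tensor H K f e h = scl K (ip H h e) f"

text \<open>
  A singular value decomposition with \<open>N \<le> \<infinity>\<close> terms, indexed from \<open>0\<close>; terms with singular
  value \<open>0\<close> are left out.
\<close>

definition is_svd ::
  "('k::rc_field, 'a::banach) hilbert \<Rightarrow> ('k, 'b::banach) hilbert \<Rightarrow> ('a \<Rightarrow> 'b) \<Rightarrow>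
   enat \<Rightarrow> (nat \<Rightarrow> real) \<Rightarrow> (nat \<Rightarrow> 'b) \<Rightarrow> (nat \<Rightarrow> 'a) \<Rightarrow> bool" where
  "is_svd H K T N \<sigma> f e \<longleftrightarrow>
     (\<forall>i. enat i < N \<longrightarrow> \<sigma> i > 0) \<and>
     (\<forall>i j. i \<le> j \<longrightarrow> enat j < N \<longrightarrow> \<sigma> j \<le> \<sigma> i) \<and>
     orthonormal_on K {i. enat i < N} f \<and> orthonormal_on H {i. enat i < N} e \<and>
     (\<forall>h. ((\<lambda>i. \<sigma> i *\<^sub>R tensor H K (f i) (e i) h) has_sum T h) {i. enat i < N})"

definition feasible_ops ::
  "('k::rc_field, 'h1::banach) hilbert \<Rightarrow> ('k, 'h2::banach) hilbert \<Rightarrow>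
   ('k, 'h3::banach) hilbert \<Rightarrow> ('k, 'h4::banach) hilbert \<Rightarrow>
   ('h3 \<Rightarrow> 'h4) \<Rightarrow> ('h1 \<Rightarrow> 'h2) \<Rightarrow> nat \<Rightarrow> ('h2 \<rightharpoonup> 'h3) set" where
  "feasible_ops H1 H2 H3 H4 B C r =
     {X. linear_operator H2 H3 X \<and> dom (mp_inverse H1 H2 C) \<subseteq> dom X \<and> edim H3 (ran X) \<le> enat r \<and>
         (\<exists>T\<in>hilbert_schmidt H1 H4. tot B \<circ>\<^sub>m X \<circ>\<^sub>m tot C = tot T)}"

text \<open>
  \<open>\<parallel>M - BXC\<parallel>\<close> in the Hilbert--Schmidt norm, for \<open>X\<close> such that \<open>BXC\<close> is everywhere defined.
\<close>

definition residual ::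
  "('k::rc_field, 'h1::banach) hilbert \<Rightarrow> ('h1 \<Rightarrow> 'h4::banach) \<Rightarrow> ('h3 \<Rightarrow> 'h4) \<Rightarrow> ('h1 \<Rightarrow> 'h2) \<Rightarrow>
   ('h2 \<rightharpoonup> 'h3) \<Rightarrow> real" where
  "residual H1 M B C X = hs_norm H1 (\<lambda>h. M h - the ((tot B \<circ>\<^sub>m X \<circ>\<^sub>m tot C) h))"

definition approximates :: "'a::banach set \<Rightarrow> nat \<Rightarrow> (nat \<Rightarrow> 'a) \<Rightarrow> (nat \<Rightarrow> nat \<Rightarrow> 'a) \<Rightarrow> bool" where
  "approximates A s f g \<longleftrightarrow>
     (\<forall>n\<ge>1. \<forall>i<s. g n i \<in> A \<and> (\<forall>m\<ge>n. norm (f i - g m i) < 1 / real n))"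

end

(*
  Write W for the closure of ran B, V for the orthogonal complement of ker C, and K = P_W M P_V.

  Lower bound. For feasible X the operator T = BXC is everywhere defined, has rank at most r and
  satisfies T = P_W T P_V, because XC vanishes on ker C. Hilbert-Schmidt orthogonality of the
  compression A |-> P_W A P_V gives |M - T|^2 = |K - T|^2 + |M - K|^2, and likewise for the truncation
  Y of K, whose singular vectors lie in W and V. The Eckart-Young-Mirsky inequality
  |K - Y| <= |K - T| then yields |M - Y| <= |M - T|.

  Attainment in the limit. Picking b_i in the orthogonal complement of ker B with B b_i = f_i^n, the
  operator X^(n) maps C x + k to the sum of lambda_i <x, e_i> b_i, for x in V and k orthogonal to
  ran C. Hence B X^(n) C = Y^(n), and |Y^(n) - Y| <= (sum of the lambda_i) / n.
*)

theory Submission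
  imports Defs
begin

subsection \<open>Inner products and projections\<close>

text \<open>The obstacle is that the left singular vectors of \<open>K\<close> are only known to lie
  in the closure of ran B, so the pseudoinverse of \<open>B\<close> need not be defined on them. The
  right ones cause no such trouble: they are orthogonal to ker C, where the pseudoinverse of
  \<open>C\<close> undoes \<open>C\<close>. Hence only the left factors are perturbed. In the
  Eckart-Young-Mirsky inequality, let \<open>V\<close> be a finite orthonormal set whose span
  contains the range of the competitor, and \<open>A\<close> the adjoint of \<open>T\<close>.
  Projecting \<open>T\<close> onto that span does at least as well as the competitor and leaves the
  squared error |T|^2 - (\<Sum>v\<in>V. |A v|^2). So only an upper bound for this sum is needed, and
  no spectral information about the competitor. \<open>hs_norm\<close> evaluates on one basis
  obtained by choice. Passing to the adjoint by exchanging a double sum frees it from that basis. It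
  also handles a projection composed on the right, where Pythagoras fails at single basis vectors:
  in the adjoint the projection stands on the left.\<close>

lemma conjg_zero [simp]: "conjg (0 :: 'k::rc_field) = 0"
  using rc_conjg_of_real[of 0, where 'k = 'k] by simp

text \<open>Not an axiom of \<open>rc_field\<close>: taking norms in \<open>mult_conjg\<close> gives
  |x| |conjg x| = |x|^2, and |x| cancels.\<close>

lemma norm_conjg [simp]: "norm (conjg x) = norm (x :: 'k::rc_field)"
proof (cases "x = 0")
  case False
  have "norm (x * conjg x) = (norm x)\<^sup>2"
    by (simp add: mult_conjg norm_power)
  then show ?thesis
    using False by (simp add: norm_mult power2_eq_square)
qed simp

lemma conjg_mult_self: "conjg x * x = of_real ((norm x)\<^sup>2)" for x :: "'k::rc_field"
  by (metis mult.commute mult_conjg)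

context hilbert_space
begin

lemma ip_add_right: "ip H x (y + z) = ip H x y + ip H x z"
  by (metis conjg_add ip_add_left ip_conjg)

lemma ip_scl_right: "ip H x (scl H c y) = conjg c * ip H x y"
  by (metis ip_scl_left rc_conjg_mult ip_conjg)

lemma ip_zero_left [simp]: "ip H 0 y = 0"
  using ip_add_left[of 0 0 y] by simp

lemma ip_zero_right [simp]: "ip H x 0 = 0"
  using ip_add_right[of x 0 0] by simp

lemma ip_minus_left: "ip H (- x) y = - ip H x y"
  using ip_add_left[of "- x" x y] by (simp add: eq_neg_iff_add_eq_0)

lemma ip_minus_right: "ip H x (- y) = - ip H x y"
  using ip_add_right[of x "- y" y] by (simp add: eq_neg_iff_add_eq_0)

lemma ip_diff_left: "ip H (x - y) z = ip H x z - ip H y z"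
  using ip_add_left[of x "- y" z] by (simp add: ip_minus_left)

lemma ip_diff_right: "ip H x (y - z) = ip H x y - ip H x z"
  using ip_add_right[of x y "- z"] by (simp add: ip_minus_right)

lemma ip_sum_left: "ip H (\<Sum>i\<in>I. x i) y = (\<Sum>i\<in>I. ip H (x i) y)"
  by (induction I rule: infinite_finite_induct) (simp_all add: ip_add_left)

lemma ip_sum_right: "ip H y (\<Sum>i\<in>I. x i) = (\<Sum>i\<in>I. ip H y (x i))"
  by (induction I rule: infinite_finite_induct) (simp_all add: ip_add_right)

lemma ip_scaleR_left: "ip H (a *\<^sub>R x) y = a *\<^sub>R ip H x y"
  by (metis ip_scl_left scl_of_real scaleR_conv_of_real)

lemma ip_scaleR_right: "ip H x (a *\<^sub>R y) = a *\<^sub>R ip H x y"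
  by (metis ip_scl_right scl_of_real scaleR_conv_of_real rc_conjg_of_real)

lemma ip_self_eq_0_iff [simp]: "ip H x x = 0 \<longleftrightarrow> x = 0"
  by (simp add: ip_norm)

lemma ip_eq_0_sym: "ip H x y = 0 \<longleftrightarrow> ip H y x = 0"
  by (metis conjg_zero ip_conjg)

lemma norm_ip_sym: "norm (ip H x y) = norm (ip H y x)"
  by (metis ip_conjg norm_conjg)

text \<open>The type class of the points gives homogeneity of the norm for real scalars; for scalars
  in \<open>'k\<close> it is recovered from \<open>ip_norm\<close>.\<close>

lemma norm_scl: "norm (scl H c x) = norm c * norm x"
proof -
  have "of_real ((norm (scl H c x))\<^sup>2) = c * conjg c * ip H x x"
    by (simp only: ip_norm[symmetric] ip_scl_left ip_scl_right mult_ac)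
  also have "\<dots> = of_real ((norm c * norm x)\<^sup>2)"
    by (simp add: mult_conjg ip_norm power_mult_distrib)
  finally have "(norm (scl H c x))\<^sup>2 = (norm c * norm x)\<^sup>2"
    by (simp only: of_real_eq_iff)
  then show ?thesis
    by simp
qed

lemma scl_scaleR: "scl H c (a *\<^sub>R x) = a *\<^sub>R scl H c x"
  by (metis scale_left_commute scl_of_real)

lemma pythagoras:
  assumes "ip H x y = 0"
  shows "(norm (x + y))\<^sup>2 = (norm x)\<^sup>2 + (norm y)\<^sup>2"
proof -
  have "of_real ((norm (x + y))\<^sup>2) = ip H x x + ip H y y"
    using assms ip_eq_0_sym[of x y] by (simp only: ip_norm[symmetric]) (simp add: ip_add_left ip_add_right)
  also have "\<dots> = of_real ((norm x)\<^sup>2 + (norm y)\<^sup>2)"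
    by (simp add: ip_norm)
  finally show ?thesis
    by (simp only: of_real_eq_iff)
qed

lemma parallelogram:
  fixes x y :: 'a
  shows "(norm (x + y))\<^sup>2 + (norm (x - y))\<^sup>2 = 2 * (norm x)\<^sup>2 + 2 * (norm y)\<^sup>2"
proof -
  have "of_real ((norm (x + y))\<^sup>2 + (norm (x - y))\<^sup>2) = ip H (x + y) (x + y) + ip H (x - y) (x - y)"
    by (simp add: ip_norm)
  also have "\<dots> = 2 * ip H x x + 2 * ip H y y"
    by (simp add: ip_add_left ip_add_right ip_diff_left ip_diff_right)
  also have "\<dots> = of_real (2 * (norm x)\<^sup>2 + 2 * (norm y)\<^sup>2)"
    by (simp add: ip_norm)
  finally show ?thesis
    by (simp only: of_real_eq_iff)
qed

text \<open>The subtracted vector is the component of \<open>x\<close> along \<open>y\<close>. For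
  \<open>y = 0\<close> the quotient is 0 by convention and the claim is trivial.\<close>

lemma orthogonal_remainder:
  "ip H (x - scl H (ip H x y / of_real ((norm y)\<^sup>2)) y) y = 0"
  by (cases "y = 0") (simp_all add: ip_diff_left ip_scl_left ip_norm)

text \<open>By Pythagoras the component \<open>z\<close> of \<open>x\<close> along \<open>y\<close>
  is no longer than \<open>x\<close>, and its length is |<x, y>| / |y|.\<close>

lemma Cauchy_Schwarz: "norm (ip H x y) \<le> norm x * norm y"
proof (cases "y = 0")
  case False
  define z where "z = scl H (ip H x y / of_real ((norm y)\<^sup>2)) y"
  have "ip H z (x - z) = 0"
    using orthogonal_remainder[of x y] by (simp add: z_def ip_scl_left ip_eq_0_sym[of y])
  from pythagoras[OF this] have "(norm z)\<^sup>2 \<le> (norm x)\<^sup>2"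
    by simp
  then have "norm z \<le> norm x"
    by (simp add: power2_le_iff_abs_le)
  then show ?thesis
    using False by (simp add: z_def norm_scl norm_divide norm_power power2_eq_square norm_mult divide_simps mult.commute
        flip: of_real_power)
qed simp

lemma bounded_linear_ip_left: "bounded_linear (\<lambda>x. ip H x y)"
  by (rule bounded_linear_intro[where K = "norm y"])
    (simp_all add: ip_add_left ip_scaleR_left Cauchy_Schwarz)

lemma bounded_linear_ip_right: "bounded_linear (\<lambda>y. ip H x y)"
  by (rule bounded_linear_intro[where K = "norm x"])
    (simp_all add: ip_add_right ip_scaleR_right norm_ip_sym[of x] Cauchy_Schwarz)

section \<open>Orthogonal complements and closures of subspaces\<close>

lemma subspace_ocomp: "subspace (ocomp H V)"
  by (rule subspaceI) (auto simp: ocomp_def ip_add_left ip_scl_left)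

lemma closed_ocomp: "closed (ocomp H V)"
proof -
  have "ocomp H V = (\<Inter>v\<in>V. {x. ip H x v = 0})"
    by (auto simp: ocomp_def)
  moreover have "closed {x. ip H x v = 0}" for v
    by (intro closed_Collect_eq continuous_intros
        linear_continuous_on[OF bounded_linear_ip_left])
  ultimately show ?thesis
    by auto
qed

text \<open>For fixed \<open>x\<close>, the set of all \<open>v\<close> with <x, v> = 0 is closed.
  Decompositions along ran C thereby serve for its closure.\<close>

lemma ocomp_closure: "ocomp H (closure V) = ocomp H V"
proof -
  have "ip H x v = 0" if "x \<in> ocomp H V" "v \<in> closure V" for x v
  proof -
    have "closed {v. ip H x v = 0}"
      by (intro closed_Collect_eq continuous_intros
          linear_continuous_on[OF bounded_linear_ip_right])
    then have "closure V \<subseteq> {v. ip H x v = 0}"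
      using that(1) by (intro closure_minimal) (auto simp: ocomp_def)
    then show ?thesis
      using that(2) by auto
  qed
  then show ?thesis
    using closure_subset[of V] by (fastforce simp: ocomp_def)
qed

lemma subset_ocomp_ocomp: "V \<subseteq> ocomp H (ocomp H V)"
  by (auto simp: ocomp_def ip_eq_0_sym)

lemma subspace_closure:
  assumes "subspace V"
  shows "subspace (closure V)"
proof (rule subspaceI)
  show "0 \<in> closure V"
    using assms closure_subset[of V] subspace_0 by blast
next
  fix x y assume "x \<in> closure V" "y \<in> closure V"
  then obtain a b where "\<And>n. a n \<in> V" "a \<longlonglongrightarrow> x" "\<And>n. b n \<in> V" "b \<longlonglongrightarrow> y"
    by (auto simp: closure_sequential)
  then have "\<forall>n. a n + b n \<in> V" "(\<lambda>n. a n + b n) \<longlonglongrightarrow> x + y"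
    using assms by (auto intro: subspace_add tendsto_add)
  then show "x + y \<in> closure V"
    unfolding closure_sequential by (intro exI[of _ "\<lambda>n. a n + b n"]) auto
next
  fix c x assume "x \<in> closure V"
  then obtain a where "\<And>n. a n \<in> V" "a \<longlonglongrightarrow> x"
    by (auto simp: closure_sequential)
  moreover have "bounded_linear (scl H c)"
    by (rule bounded_linear_intro[where K = "norm c"])
      (simp_all add: scale_right_distrib scl_scaleR norm_scl)
  ultimately have "\<forall>n. scl H c (a n) \<in> V" "(\<lambda>n. scl H c (a n)) \<longlonglongrightarrow> scl H c x"
    using assms by (auto intro: subspace_scale bounded_linear.tendsto)
  then show "scl H c x \<in> closure V"
    unfolding closure_sequential by (intro exI[of _ "\<lambda>n. scl H c (a n)"]) auto
qed

section \<open>Nearest points, orthogonal projections and the Riesz representation\<close>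

lemma nearest_point_exists:
  assumes V: "subspace V" "closed V"
  shows "\<exists>p\<in>V. \<forall>v\<in>V. norm (x - p) \<le> norm (x - v)"
proof -
  define D where "D = (\<lambda>v. (norm (x - v))\<^sup>2) ` V"
  define d where "d = Inf D"
  have D0: "D \<noteq> {}" and bdd: "bdd_below D"
    using subspace_0[OF V(1)] by (auto simp: D_def intro!: bdd_belowI[of _ 0])
  have d_le: "d \<le> (norm (x - v))\<^sup>2" if "v \<in> V" for v
    unfolding d_def using bdd that by (intro cInf_lower) (auto simp: D_def)
  have "\<exists>v\<in>V. (norm (x - v))\<^sup>2 < d + 1 / real (Suc n)" for n
    using cInf_lessD[OF D0, of "d + 1 / real (Suc n)"] by (auto simp: d_def D_def)
  then obtain a where a: "\<And>n. a n \<in> V" "\<And>n. (norm (x - a n))\<^sup>2 < d + 1 / real (Suc n)"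
    by metis
  \<comment> \<open>The midpoint of \<open>a m\<close> and \<open>a n\<close> lies in
    \<open>V\<close>, so its squared distance to \<open>x\<close> is at least \<open>d\<close>. The
    parallelogram law then leaves only the two excesses over \<open>d\<close>, doubled.\<close>
  have dist: "(norm (a m - a n))\<^sup>2 \<le> 2 / real (Suc m) + 2 / real (Suc n)" for m n
  proof -
    have mid: "(1/2) *\<^sub>R (a m + a n) \<in> V"
      using V(1) a(1) by (metis scl_of_real subspace_add subspace_scale)
    have "(x - a m) + (x - a n) = 2 *\<^sub>R (x - (1/2) *\<^sub>R (a m + a n))"
      by (simp add: scaleR_right_diff_distrib scaleR_2 algebra_simps)
    then have "(norm ((x - a m) + (x - a n)))\<^sup>2 = 4 * (norm (x - (1/2) *\<^sub>R (a m + a n)))\<^sup>2"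
      by (simp add: power_mult_distrib)
    moreover have "norm ((x - a m) - (x - a n)) = norm (a m - a n)"
      by (simp add: norm_minus_commute)
    ultimately show ?thesis
      using parallelogram[of "x - a m" "x - a n"] d_le[OF mid] a(2)[of m] a(2)[of n]
      by simp
  qed
  have "Cauchy a"
  proof (rule metric_CauchyI)
    fix \<epsilon> :: real assume "\<epsilon> > 0"
    obtain k where k: "4 / real (Suc k) < \<epsilon>\<^sup>2"
      using \<open>\<epsilon> > 0\<close> reals_Archimedean[of "\<epsilon>\<^sup>2 / 4"] by (auto simp: field_simps)
    have "dist (a m) (a n) < \<epsilon>" if "m \<ge> k" "n \<ge> k" for m n
    proof -
      have "2 / real (Suc m) \<le> 2 / real (Suc k)" "2 / real (Suc n) \<le> 2 / real (Suc k)"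
        using that by (auto intro!: divide_left_mono)
      then have "(norm (a m - a n))\<^sup>2 < \<epsilon>\<^sup>2"
        using dist[of m n] k by simp
      then show ?thesis
        using \<open>\<epsilon> > 0\<close> by (simp add: dist_norm power2_less_imp_less)
    qed
    then show "\<exists>k. \<forall>m\<ge>k. \<forall>n\<ge>k. dist (a m) (a n) < \<epsilon>"
      by blast
  qed
  then obtain p where p: "a \<longlonglongrightarrow> p"
    using Cauchy_convergent convergent_def by blast
  have "p \<in> V"
    using closed_sequentially[OF V(2) _ p] a(1) by blast
  moreover have "norm (x - p) \<le> norm (x - v)" if "v \<in> V" for v
  proof -
    have "(\<lambda>n. (norm (x - a n))\<^sup>2) \<longlonglongrightarrow> (norm (x - p))\<^sup>2"
      by (intro tendsto_intros p)
    moreover have "(\<lambda>n. d + 1 / real (Suc n)) \<longlonglongrightarrow> d + 0"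
      by (intro tendsto_intros LIMSEQ_Suc lim_1_over_n)
    ultimately have "(norm (x - p))\<^sup>2 \<le> d"
      using a(2) by (intro LIMSEQ_le[of _ _ _ d]) (auto intro: less_imp_le)
    then have "(norm (x - p))\<^sup>2 \<le> (norm (x - v))\<^sup>2"
      using d_le[OF that] by linarith
    then show ?thesis
      by (simp add: power2_le_iff_abs_le)
  qed
  ultimately show ?thesis
    by blast
qed

text \<open>If \<open>z\<close> is the component of \<open>x - p\<close> along a vector of
  \<open>V\<close>, moving the nearest point \<open>p\<close> to \<open>p + z\<close> lowers the
  squared distance by |z|^2, which forces \<open>z = 0\<close>.\<close>

lemma projection_exists:
  assumes V: "subspace V" "closed V"
  obtains p where "p \<in> V" "x - p \<in> ocomp H V"
proof -
  obtain p where p: "p \<in> V" and min: "\<And>v. v \<in> V \<Longrightarrow> norm (x - p) \<le> norm (x - v)"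
    using nearest_point_exists[OF V, of x] by blast
  have "ip H (x - p) v = 0" if "v \<in> V" for v
  proof (cases "v = 0")
    case False
    define z where "z = scl H (ip H (x - p) v / of_real ((norm v)\<^sup>2)) v"
    have "ip H z (x - p - z) = 0"
      using orthogonal_remainder[of "x - p" v] by (simp add: z_def ip_scl_left ip_eq_0_sym[of v])
    from pythagoras[OF this] have "(norm (x - p))\<^sup>2 = (norm z)\<^sup>2 + (norm (x - (p + z)))\<^sup>2"
      by (simp add: algebra_simps)
    moreover have "p + z \<in> V"
      unfolding z_def by (intro subspace_add subspace_scale V p that)
    then have "(norm (x - p))\<^sup>2 \<le> (norm (x - (p + z)))\<^sup>2"
      using min by (simp add: power_mono)
    ultimately have "z = 0"
      by simp
    then show ?thesis
      using False by (auto simp: z_def)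
  qed simp
  then show ?thesis
    using p that by (auto simp: ocomp_def)
qed

text \<open>Two candidates differ by a vector that lies in \<open>V\<close> and is orthogonal to
  \<open>V\<close>. Values of \<open>proj\<close> are computed by this rule throughout.\<close>

lemma proj_unique:
  assumes "subspace V" "p \<in> V" "x - p \<in> ocomp H V"
  shows "proj H V x = p"
  unfolding proj_def
proof (rule the_equality)
  fix q assume q: "q \<in> V \<and> x - q \<in> ocomp H V"
  then have "(x - p) - (x - q) \<in> ocomp H V"
    using assms subspace_diff[OF subspace_ocomp] by blast
  moreover have "(x - p) - (x - q) \<in> V"
    using subspace_diff[OF assms(1)] q assms(2) by simp
  ultimately show "q = p"
    by (auto simp: ocomp_def)
qed (use assms in auto)

lemma
  assumes "subspace V" "closed V"
  shows proj_mem: "proj H V x \<in> V" and diff_proj_mem: "x - proj H V x \<in> ocomp H V"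
proof -
  obtain p where "p \<in> V" "x - p \<in> ocomp H V"
    using projection_exists[OF assms] .
  then show "proj H V x \<in> V" "x - proj H V x \<in> ocomp H V"
    using proj_unique[OF assms(1)] by auto
qed

lemma proj_add:
  assumes V: "subspace V" "closed V"
  shows "proj H V (x + y) = proj H V x + proj H V y"
proof (rule proj_unique[OF V(1)])
  have "(x - proj H V x) + (y - proj H V y) \<in> ocomp H V"
    by (intro subspace_add[OF subspace_ocomp] diff_proj_mem V)
  then show "x + y - (proj H V x + proj H V y) \<in> ocomp H V"
    by (simp add: algebra_simps)
qed (intro subspace_add proj_mem V)

lemma proj_scl:
  assumes V: "subspace V" "closed V"
  shows "proj H V (scl H c x) = scl H c (proj H V x)"
proof (rule proj_unique[OF V(1)])
  have "scl H c (x - proj H V x) \<in> ocomp H V"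
    by (intro subspace_scale[OF subspace_ocomp] diff_proj_mem V)
  then show "scl H c x - scl H c (proj H V x) \<in> ocomp H V"
    by (simp add: scale_right_diff_distrib)
qed (intro subspace_scale proj_mem V)

lemma norm_proj_decomp:
  assumes V: "subspace V" "closed V"
  shows "(norm x)\<^sup>2 = (norm (proj H V x))\<^sup>2 + (norm (x - proj H V x))\<^sup>2"
  using pythagoras[of "proj H V x" "x - proj H V x"] proj_mem[OF V] diff_proj_mem[OF V]
  by (auto simp: ocomp_def ip_eq_0_sym[of "proj H V x"])

lemma norm_proj_le:
  assumes "subspace V" "closed V"
  shows "norm (proj H V x) \<le> norm x"
proof (rule power2_le_imp_le)
  show "(norm (proj H V x))\<^sup>2 \<le> (norm x)\<^sup>2"
    unfolding norm_proj_decomp[OF assms, of x] by simp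
qed simp

lemma ip_proj_left:
  assumes V: "subspace V" "closed V"
  shows "ip H (proj H V x) y = ip H x (proj H V y)"
proof -
  have "ip H (proj H V x) (y - proj H V y) = 0" "ip H (x - proj H V x) (proj H V y) = 0"
    using proj_mem[OF V] diff_proj_mem[OF V] by (auto simp: ocomp_def ip_eq_0_sym[of "proj H V x"])
  then show ?thesis
    by (simp add: ip_diff_left ip_diff_right)
qed

lemma proj_ocomp:
  assumes V: "subspace V" "closed V"
  shows "proj H (ocomp H V) x = x - proj H V x"
  using proj_mem[OF V] diff_proj_mem[OF V] subset_ocomp_ocomp
  by (intro proj_unique subspace_ocomp) auto

lemma proj_ocomp_mem: "proj H (ocomp H V) x \<in> ocomp H V"
  by (rule proj_mem[OF subspace_ocomp closed_ocomp])

lemma proj_bounded_op: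
  assumes V: "subspace V" "closed V"
  shows "proj H V \<in> bounded_op H H"
  unfolding bounded_op_def
  using proj_add[OF V] proj_scl[OF V] norm_proj_le[OF V] vector_space_axioms
  by (auto simp: Vector_Spaces.linear_iff intro!: exI[of _ 1])

text \<open>If \<phi> is not zero, its kernel is closed and some \<open>z\<close> orthogonal to it
  has \<open>\<phi> z \<noteq> 0\<close>. The vector
  \<open>scl H (\<phi> z) x - scl H (\<phi> x) z\<close> lies in the kernel, and pairing it with
  \<open>z\<close> expresses \<open>\<phi> x\<close> through <x, z>.\<close>

lemma Riesz:
  assumes add: "\<And>x y. \<phi> (x + y) = \<phi> x + \<phi> y" and scl: "\<And>c x. \<phi> (scl H c x) = c * \<phi> x"
    and bd: "\<And>x. norm (\<phi> x) \<le> c * norm x"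
  obtains u where "\<And>x. \<phi> x = ip H x u"
proof (cases "\<forall>x. \<phi> x = 0")
  case True
  then show ?thesis
    using that[of 0] by simp
next
  case False
  then obtain x0 where x0: "\<phi> x0 \<noteq> 0"
    by blast
  have lin: "bounded_linear \<phi>"
    by (rule bounded_linear_intro[where K = c])
      (use add scl[of "of_real _"] bd in \<open>auto simp: scl_of_real scaleR_conv_of_real mult.commute\<close>)
  have diff: "\<phi> (x - y) = \<phi> x - \<phi> y" for x y
    by (simp add: bounded_linear.linear[OF lin] linear_diff)
  have V: "subspace {x. \<phi> x = 0}" "closed {x. \<phi> x = 0}"
    using scl[of 0 0] by (auto intro!: subspaceI closed_Collect_eq linear_continuous_on lin
        simp: add scl)
  define z where "z = x0 - proj H {x. \<phi> x = 0} x0"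
  have z: "\<phi> z \<noteq> 0" and orth: "\<And>x. \<phi> x = 0 \<Longrightarrow> ip H z x = 0"
    using x0 proj_mem[OF V, of x0] diff_proj_mem[OF V, of x0] by (auto simp: z_def diff ocomp_def)
  then have "z \<noteq> 0"
    using scl[of 0 0] by auto
  show ?thesis
  proof (rule that)
    fix x
    have "ip H z (scl H (\<phi> z) x - scl H (\<phi> x) z) = 0"
      by (rule orth) (simp add: diff scl)
    then have "ip H (scl H (\<phi> z) x - scl H (\<phi> x) z) z = 0"
      using ip_eq_0_sym by blast
    then have "\<phi> z * ip H x z = \<phi> x * ip H z z"
      by (simp add: ip_diff_left ip_scl_left)
    then show "\<phi> x = ip H x (scl H (conjg (\<phi> z / ip H z z)) z)"
      using \<open>z \<noteq> 0\<close> by (simp add: ip_scl_right rc_conjg_conjg field_simps)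
  qed
qed

subsection \<open>Orthonormal systems and bases\<close>

lemma orthonormal_onD:
  assumes "orthonormal_on H I e" "i \<in> I" "j \<in> I"
  shows "ip H (e i) (e j) = (if i = j then 1 else 0)"
  using assms by (auto simp: orthonormal_on_def)

lemma orthonormal_norm:
  assumes "orthonormal_on H I e" "i \<in> I"
  shows "norm (e i) = 1"
proof -
  have "of_real ((norm (e i))\<^sup>2) = (of_real 1 :: 'k)"
    using orthonormal_onD[OF assms assms(2)] by (simp only: ip_norm[symmetric]) simp
  then have "(norm (e i))\<^sup>2 = 1"
    by (simp only: of_real_eq_iff)
  then show ?thesis
    by (simp add: power2_eq_1_iff) (metis norm_ge_zero neg_0_le_iff_le not_one_le_zero)
qed

lemma orthonormal_on_subset: "orthonormal_on H I e \<Longrightarrow> J \<subseteq> I \<Longrightarrow> orthonormal_on H J e"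
  unfolding orthonormal_on_def by blast

lemma ip_orthonormal_sum:
  assumes "orthonormal_on H I e" "finite I" "j \<in> I"
  shows "ip H (\<Sum>i\<in>I. scl H (c i) (e i)) (e j) = c j"
proof -
  have "ip H (\<Sum>i\<in>I. scl H (c i) (e i)) (e j) = (\<Sum>i\<in>I. if i = j then c i else 0)"
    unfolding ip_sum_left using assms by (intro sum.cong) (auto simp: ip_scl_left orthonormal_on_def)
  then show ?thesis
    using assms by simp
qed

lemma norm_orthonormal_sum:
  assumes "orthonormal_on H I e" "finite I"
  shows "(norm (\<Sum>i\<in>I. scl H (c i) (e i)))\<^sup>2 = (\<Sum>i\<in>I. (norm (c i))\<^sup>2)"
proof -
  let ?p = "\<Sum>i\<in>I. scl H (c i) (e i)"
  have "of_real ((norm ?p)\<^sup>2) = (\<Sum>j\<in>I. conjg (c j) * ip H ?p (e j))"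
    by (simp only: ip_norm[symmetric] ip_sum_right ip_scl_right)
  also have "\<dots> = (\<Sum>j\<in>I. conjg (c j) * c j)"
    using ip_orthonormal_sum[OF assms] by (intro sum.cong) auto
  also have "\<dots> = of_real (\<Sum>i\<in>I. (norm (c i))\<^sup>2)"
    by (simp add: conjg_mult_self)
  finally show ?thesis
    by (simp only: of_real_eq_iff)
qed

text \<open>For a finite orthonormal family this is the orthogonal projection onto its span, in a
  form that exposes the coefficients.\<close>

definition fourier_sum :: "'i set \<Rightarrow> ('i \<Rightarrow> 'a) \<Rightarrow> 'a \<Rightarrow> 'a" where
  "fourier_sum I e x = (\<Sum>i\<in>I. scl H (ip H x (e i)) (e i))"

lemma fourier_sum_span: "fourier_sum I e x \<in> span (e ` I)"
  unfolding fourier_sum_def by (intro span_sum span_scale span_base) auto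

lemma diff_fourier_sum_orthogonal:
  assumes "orthonormal_on H I e" "finite I" "v \<in> span (e ` I)"
  shows "ip H (x - fourier_sum I e x) v = 0"
proof -
  have "subspace {v. ip H (x - fourier_sum I e x) v = 0}"
    by (rule subspaceI) (auto simp: ip_add_right ip_scl_right)
  moreover have "e ` I \<subseteq> {v. ip H (x - fourier_sum I e x) v = 0}"
    using ip_orthonormal_sum[OF assms(1,2)] by (auto simp: fourier_sum_def ip_diff_left)
  ultimately show ?thesis
    using span_minimal assms(3) by blast
qed

lemma fourier_sum_eq:
  assumes "orthonormal_on H I e" "finite I" "x \<in> span (e ` I)"
  shows "fourier_sum I e x = x"
proof -
  have "x - fourier_sum I e x \<in> span (e ` I)"
    by (intro span_diff assms fourier_sum_span)
  then have "ip H (x - fourier_sum I e x) (x - fourier_sum I e x) = 0"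
    by (rule diff_fourier_sum_orthogonal[OF assms(1,2)])
  then show ?thesis
    by simp
qed

lemma Bessel_identity:
  assumes "orthonormal_on H I e" "finite I"
  shows "(norm x)\<^sup>2 = (\<Sum>i\<in>I. (norm (ip H x (e i)))\<^sup>2) + (norm (x - fourier_sum I e x))\<^sup>2"
proof -
  have "ip H (fourier_sum I e x) (x - fourier_sum I e x) = 0"
    using diff_fourier_sum_orthogonal[OF assms fourier_sum_span] ip_eq_0_sym by blast
  from pythagoras[OF this] show ?thesis
    using norm_orthonormal_sum[OF assms] by (simp add: fourier_sum_def)
qed

lemma Bessel_inequality:
  assumes "orthonormal_on H I e" "finite I"
  shows "(\<Sum>i\<in>I. (norm (ip H x (e i)))\<^sup>2) \<le> (norm x)\<^sup>2"
  using Bessel_identity[OF assms, of x] by simp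

lemma fourier_sum_best_approximation:
  assumes "orthonormal_on H I e" "finite I" "v \<in> span (e ` I)"
  shows "norm (x - fourier_sum I e x) \<le> norm (x - v)"
proof -
  have "ip H (x - fourier_sum I e x) (fourier_sum I e x - v) = 0"
    by (intro diff_fourier_sum_orthogonal assms span_diff fourier_sum_span)
  from pythagoras[OF this] have "(norm (x - fourier_sum I e x))\<^sup>2 \<le> (norm (x - v))\<^sup>2"
    by simp
  then show ?thesis
    by (simp add: power2_le_iff_abs_le)
qed

text \<open>Bessel gives summability and one inequality. For the other, a vector of the span close
  to \<open>x\<close> involves only a finite \<open>I\<close>, and the Fourier sum over
  \<open>I\<close> is at least as close.\<close>

lemma Parseval:
  assumes E: "is_onb H E"
  shows "((\<lambda>e. (norm (ip H x e))\<^sup>2) has_sum (norm x)\<^sup>2) E"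
proof -
  let ?f = "\<lambda>e. (norm (ip H x e))\<^sup>2"
  have on: "orthonormal_on H I (\<lambda>x. x)" if "I \<subseteq> E" for I
    using E that orthonormal_on_subset by (auto simp: is_onb_def)
  have le: "sum ?f I \<le> (norm x)\<^sup>2" if "finite I" "I \<subseteq> E" for I
    using Bessel_inequality[OF on[OF that(2)] that(1)] .
  have summ: "?f summable_on E"
    by (rule nonneg_bdd_above_summable_on) (use le in \<open>auto intro!: bdd_aboveI[of _ "(norm x)\<^sup>2"]\<close>)
  have "(norm x)\<^sup>2 \<le> infsum ?f E + \<epsilon>" if "\<epsilon> > 0" for \<epsilon> :: real
  proof -
    have "x \<in> closure (span E)"
      using E by (simp add: is_onb_def)
    \<comment> \<open>The square root appears because Bessel's identity compares squared
      norms.\<close>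
    moreover have "sqrt \<epsilon> > 0"
      using that by simp
    ultimately obtain y where y: "y \<in> span E" "dist y x < sqrt \<epsilon>"
      unfolding closure_approachable by blast
    then obtain I c where I: "finite I" "I \<subseteq> E" and "y = (\<Sum>a\<in>I. scl H (c a) a)"
      unfolding span_explicit by blast
    then have "y \<in> span I"
      by (simp add: span_base span_scale span_sum)
    have "norm (x - fourier_sum I (\<lambda>x. x) x) \<le> norm (x - y)"
      using I \<open>y \<in> span I\<close> by (intro fourier_sum_best_approximation on) auto
    also have "\<dots> \<le> sqrt \<epsilon>"
      using y(2) by (simp add: dist_norm norm_minus_commute)
    finally have "(norm (x - fourier_sum I (\<lambda>x. x) x))\<^sup>2 \<le> \<epsilon>"
      using that by (simp add: sqrt_ge_absD)
    moreover have "sum ?f I \<le> infsum ?f E"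
      using I by (intro finite_sum_le_infsum summ) auto
    ultimately show ?thesis
      using Bessel_identity[OF on[OF I(2)] I(1), of x] by simp
  qed
  then have "(norm x)\<^sup>2 \<le> infsum ?f E"
    by (rule field_le_epsilon)
  moreover have "infsum ?f E \<le> (norm x)\<^sup>2"
    by (rule infsum_le_finite_sums[OF summ le])
  ultimately show ?thesis
    using summ by (simp add: has_sum_iff)
qed

text \<open>Zorn's lemma: if the span of a maximal orthonormal set were not dense, the normalized
  remainder of some vector after projection onto its closure could be added.\<close>

lemma onb_exists: "\<exists>E. is_onb H E"
proof -
  let ?A = "{E. orthonormal_on H E (\<lambda>x. x)}"
  have "\<exists>M\<in>?A. \<forall>X\<in>?A. M \<subseteq> X \<longrightarrow> X = M"
  proof (rule subset_Zorn')
    fix C assume C: "subset.chain ?A C"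
    \<comment> \<open>Members of a chain are comparable, so both vectors lie in a single orthonormal
      set.\<close>
    have "ip H a b = (if a = b then 1 else 0)" if "a \<in> X" "X \<in> C" "b \<in> Z" "Z \<in> C" for a b X Z
    proof -
      have "X \<subseteq> Z \<or> Z \<subseteq> X" "X \<in> ?A" "Z \<in> ?A"
        using C that by (auto simp: subset.chain_def)
      then show ?thesis
        using that by (auto simp: orthonormal_on_def)
    qed
    then show "\<Union>C \<in> ?A"
      by (auto simp: orthonormal_on_def)
  qed
  then obtain E where E: "orthonormal_on H E (\<lambda>x. x)"
    and max: "\<And>X. orthonormal_on H X (\<lambda>x. x) \<Longrightarrow> E \<subseteq> X \<Longrightarrow> X = E"
    by blast
  let ?V = "closure (span E)"
  have V: "subspace ?V" "closed ?V"
    by (auto intro: subspace_closure)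
  have EV: "E \<subseteq> ?V"
    using span_superset closure_subset by blast
  have "x \<in> ?V" for x
  proof (rule ccontr)
    assume x: "x \<notin> ?V"
    define z where "z = x - proj H ?V x"
    define u where "u = (1 / norm z) *\<^sub>R z"
    have "z \<noteq> 0"
      using x proj_mem[OF V, of x] by (auto simp: z_def)
    then have nu: "ip H u u = 1"
      by (simp add: ip_norm u_def)
    have "ip H z v = 0" if "v \<in> E" for v
      using diff_proj_mem[OF V, of x] EV that by (auto simp: z_def ocomp_def)
    then have uE: "ip H u v = 0" "ip H v u = 0" if "v \<in> E" for v
      using that ip_eq_0_sym[of u v] by (auto simp: u_def ip_scaleR_left)
    then have "orthonormal_on H (insert u E) (\<lambda>x. x)"
      using E nu by (auto simp: orthonormal_on_def)
    then have "u \<in> E"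
      using max[of "insert u E"] by blast
    then show False
      using uE(1)[of u] nu by simp
  qed
  then show ?thesis
    using E by (auto simp: is_onb_def)
qed

text \<open>Gram-Schmidt, one vector at a time; a vector already in the span adds nothing, so the
  cardinality is bounded by \<open>card b\<close>.\<close>

lemma orthonormal_spanning_set:
  assumes "finite b"
  obtains V where "finite V" "card V \<le> card b" "orthonormal_on H V (\<lambda>x. x)" "span b \<subseteq> span V"
proof -
  have "\<exists>V. finite V \<and> card V \<le> card b \<and> orthonormal_on H V (\<lambda>x. x) \<and> b \<subseteq> span V"
    using assms
  proof induction
    case empty
    show ?case
      by (intro exI[of _ "{}"]) (auto simp: orthonormal_on_def)
  next
    case (insert a b)
    then obtain V where V: "finite V" "card V \<le> card b" "orthonormal_on H V (\<lambda>x. x)" "b \<subseteq> span V"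
      by blast
    define z where "z = a - fourier_sum V (\<lambda>x. x) a"
    have a: "a = fourier_sum V (\<lambda>x. x) a + z"
      by (simp add: z_def)
    have fs: "fourier_sum V (\<lambda>x. x) a \<in> span V"
      using fourier_sum_span[of V "\<lambda>x. x" a] by simp
    show ?case
    proof (cases "z = 0")
      case True
      then show ?thesis
        using V a fs insert.hyps by (intro exI[of _ V]) auto
    next
      case False
      define u where "u = (1 / norm z) *\<^sub>R z"
      have nu: "ip H u u = 1"
        using False by (simp add: ip_norm u_def)
      have "ip H z v = 0" if "v \<in> V" for v
        unfolding z_def using V that by (intro diff_fourier_sum_orthogonal) (auto intro: span_base)
      then have uV: "ip H u v = 0" "ip H v u = 0" if "v \<in> V" for v
        using that ip_eq_0_sym[of u v] by (auto simp: u_def ip_scaleR_left)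
      then have "orthonormal_on H (insert u V) (\<lambda>x. x)"
        using V nu by (auto simp: orthonormal_on_def)
      moreover have "z = scl H (of_real (norm z)) u"
        using False by (simp add: u_def scl_of_real)
      then have "z \<in> span (insert u V)"
        by (metis insertI1 span_base span_scale)
      then have "a \<in> span (insert u V)"
        using fs span_mono[of V "insert u V"] by (subst a) (auto intro: span_add)
      moreover have "b \<subseteq> span (insert u V)"
        using V(4) span_mono[of V "insert u V"] by blast
      moreover have "u \<notin> V"
        using uV(1)[of u] nu by auto
      ultimately show ?thesis
        using V insert.hyps by (intro exI[of _ "insert u V"]) auto
    qed
  qed
  then show ?thesis
    using that by (metis span_minimal subspace_span)
qed

end

subsection \<open>Adjoints and Hilbert--Schmidt operators\<close>

lemma
  assumes "T \<in> bounded_op H K"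
  shows bounded_op_add: "T (x + y) = T x + T y"
    and bounded_op_scl: "T (scl H c x) = scl K c (T x)"
  using assms by (auto simp: bounded_op_def Vector_Spaces.linear_iff)

text \<open>On the zero space the constant of the definition may be negative; a nonnegative one can
  be multiplied into inequalities.\<close>

lemma bounded_op_bound:
  assumes "T \<in> bounded_op H K"
  obtains c where "c \<ge> 0" "\<And>x. norm (T x) \<le> c * norm x"
proof -
  obtain c where c: "\<And>x. norm (T x) \<le> c * norm x"
    using assms by (auto simp: bounded_op_def)
  have "norm (T x) \<le> max c 0 * norm x" for x
    using c[of x] by (rule order_trans) (simp add: mult_right_mono)
  then show ?thesis
    using that[of "max c 0"] by simp
qed

lemma bounded_op_zero:
  assumes "T \<in> bounded_op H K"
  shows "T 0 = 0"
  using bounded_op_add[OF assms, of 0 0] by simp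

lemma bounded_op_minus:
  assumes "T \<in> bounded_op H K"
  shows "T (- x) = - T x"
  using bounded_op_add[OF assms, of "- x" x] bounded_op_zero[OF assms] by (simp add: eq_neg_iff_add_eq_0)

lemma bounded_op_diff:
  assumes "T \<in> bounded_op H K"
  shows "T (x - y) = T x - T y"
  using bounded_op_add[OF assms, of x "- y"] bounded_op_minus[OF assms] by simp

lemma bounded_op_comp:
  assumes "T \<in> bounded_op H K" "S \<in> bounded_op K L"
  shows "S \<circ> T \<in> bounded_op H L"
proof -
  obtain c d where "c \<ge> 0" "\<And>x. norm (T x) \<le> c * norm x" "d \<ge> 0" "\<And>x. norm (S x) \<le> d * norm x"
    using assms by (meson bounded_op_bound)
  then have "norm (S (T x)) \<le> d * c * norm x" for x
    by (metis mult.assoc mult_left_mono order_trans)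
  moreover have "Vector_Spaces.linear (scl H) (scl L) (S \<circ> T)"
    using assms by (auto simp: bounded_op_def intro: Vector_Spaces.linear_compose)
  ultimately show ?thesis
    by (auto simp: bounded_op_def)
qed

section \<open>Adjoints and independence of the Hilbert-Schmidt norm from the basis\<close>

text \<open>A relation rather than an operation, so that adjoints of composites and differences can
  be written down and verified by computing inner products.\<close>

definition adjoint_pair ::
  "('k::rc_field, 'a::banach) hilbert \<Rightarrow> ('k, 'b::banach) hilbert \<Rightarrow> ('a \<Rightarrow> 'b) \<Rightarrow> ('b \<Rightarrow> 'a) \<Rightarrow> bool" where
  "adjoint_pair H K T A \<longleftrightarrow> (\<forall>x y. ip K (T x) y = ip H x (A y))"

locale hilbert_pair = H: hilbert_space H + K: hilbert_space K
  for H :: "('k::rc_field, 'a::banach) hilbert" and K :: "('k, 'b::banach) hilbert"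
begin

lemma adjoint_pair_sym: "adjoint_pair H K T A \<Longrightarrow> adjoint_pair K H A T"
  unfolding adjoint_pair_def by (metis H.ip_conjg K.ip_conjg)

lemma adjoint_exists:
  assumes T: "T \<in> bounded_op H K"
  obtains A where "adjoint_pair H K T A"
proof -
  obtain c where c: "c \<ge> 0" "\<And>x. norm (T x) \<le> c * norm x"
    using T by (meson bounded_op_bound)
  have "\<exists>u. \<forall>x. ip K (T x) y = ip H x u" for y
  proof -
    have "norm (ip K (T x) y) \<le> (c * norm y) * norm x" for x
      using K.Cauchy_Schwarz[of "T x" y] mult_right_mono[OF c(2)[of x], of "norm y"]
      by (simp add: mult_ac)
    from H.Riesz[OF _ _ this] show ?thesis
      by (auto simp: bounded_op_add[OF T] bounded_op_scl[OF T] K.ip_add_left K.ip_scl_left)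
  qed
  then show ?thesis
    using that unfolding adjoint_pair_def by metis
qed

lemma hs_sum_adjoint:
  assumes adj: "adjoint_pair H K T A" and E: "is_onb H E" and F: "is_onb K F"
    and sum: "((\<lambda>e. (norm (T e))\<^sup>2) has_sum S) E"
  shows "((\<lambda>f. (norm (A f))\<^sup>2) has_sum S) F"
proof -
  \<comment> \<open>By Parseval, both sums are the sum of \<open>\<bar>\<langle>T e, f\<rangle>\<bar>\<^sup>2\<close> over \<open>E \<times> F\<close>.\<close>
  define a where "a = (\<lambda>(e, f). (norm (ip K (T e) f))\<^sup>2)"
  have row: "((\<lambda>f. a (e, f)) has_sum (norm (T e))\<^sup>2) F" for e
    using K.Parseval[OF F] by (simp add: a_def)
  \<comment> \<open>The terms are nonnegative, so summable rows with summable row sums give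
    summability over the product, and the two summations may be exchanged.\<close>
  have "(a has_sum S) (E \<times> F)"
    using row sum
    by (intro has_sum_SigmaI summable_on_SigmaI[where g = "\<lambda>e. (norm (T e))\<^sup>2"])
      (auto simp: a_def intro: has_sum_imp_summable)
  then have "((\<lambda>(f, e). a (e, f)) has_sum S) (F \<times> E)"
    by (rule iffD1[OF has_sum_swap])
  moreover have "((\<lambda>e. a (e, f)) has_sum (norm (A f))\<^sup>2) E" for f
    using H.Parseval[OF E, of "A f"] adj
    by (simp add: a_def adjoint_pair_def H.norm_ip_sym[of "A f"])
  ultimately show ?thesis
    by (intro has_sum_SigmaD[where S = S and A = F and B = "\<lambda>_. E"]) auto
qed

text \<open>Two uses of \<open>hs_sum_adjoint\<close>: from \<open>E\<close> to a basis
  \<open>F\<close> of the other space for the adjoint, then to \<open>E'\<close> for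
  \<open>T\<close>, which is the adjoint of its adjoint.\<close>

lemma hs_sum_basis_change:
  assumes T: "T \<in> bounded_op H K" and E: "is_onb H E" "is_onb H E'"
    and sum: "((\<lambda>e. (norm (T e))\<^sup>2) has_sum S) E"
  shows "((\<lambda>e. (norm (T e))\<^sup>2) has_sum S) E'"
proof -
  interpret KH: hilbert_pair K H ..
  obtain A where A: "adjoint_pair H K T A"
    using adjoint_exists[OF T] .
  obtain F where F: "is_onb K F"
    using K.onb_exists by blast
  show ?thesis
    by (rule KH.hs_sum_adjoint[OF adjoint_pair_sym[OF A] F E(2)
          hs_sum_adjoint[OF A E(1) F sum]])
qed

text \<open>By basis independence, a sum computed over any convenient basis determines the value
  that \<open>hs_norm\<close> takes from its chosen one.\<close>

lemma hilbert_schmidtI: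
  assumes T: "T \<in> bounded_op H K" and E: "is_onb H E"
    and sum: "((\<lambda>e. (norm (T e))\<^sup>2) has_sum S) E"
  shows "T \<in> hilbert_schmidt H K" and "(hs_norm H T)\<^sup>2 = S"
proof -
  show "T \<in> hilbert_schmidt H K"
    using assms by (auto simp: hilbert_schmidt_def dest: has_sum_imp_summable)
  have "is_onb H (SOME E. is_onb H E)"
    using E by (rule someI)
  then have "((\<lambda>e. (norm (T e))\<^sup>2) has_sum S) (SOME E. is_onb H E)"
    using hs_sum_basis_change[OF T E _ sum] by blast
  moreover from this have "S \<ge> 0"
    by (rule has_sum_nonneg) simp
  ultimately show "(hs_norm H T)\<^sup>2 = S"
    by (simp add: hs_norm_def infsumI)
qed

lemma hs_has_sum:
  assumes T: "T \<in> hilbert_schmidt H K" and E: "is_onb H E"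
  shows "((\<lambda>e. (norm (T e))\<^sup>2) has_sum (hs_norm H T)\<^sup>2) E"
proof -
  obtain E0 S where "T \<in> bounded_op H K" "is_onb H E0" "((\<lambda>e. (norm (T e))\<^sup>2) has_sum S) E0"
    using T by (auto simp: hilbert_schmidt_def summable_on_def)
  then show ?thesis
    using hs_sum_basis_change[OF _ _ E] hilbert_schmidtI(2) by metis
qed

lemma hs_norm_nonneg: "hs_norm H T \<ge> 0"
  unfolding hs_norm_def by (auto intro: infsum_nonneg)

section \<open>Sums of Hilbert-Schmidt operators, the triangle inequality and rank-one
  operators\<close>

lemma bounded_op_plus:
  assumes S: "S \<in> bounded_op H K" and T: "T \<in> bounded_op H K"
  shows "(\<lambda>x. S x + T x) \<in> bounded_op H K"
proof -
  obtain c d where c: "\<And>x. norm (S x) \<le> c * norm x" and d: "\<And>x. norm (T x) \<le> d * norm x"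
    using assms by (meson bounded_op_bound)
  have "norm (S x + T x) \<le> (c + d) * norm x" for x
    using norm_triangle_ineq[of "S x" "T x"] c[of x] d[of x] by (simp add: algebra_simps)
  then show ?thesis
    using bounded_op_add[OF S] bounded_op_add[OF T] bounded_op_scl[OF S] bounded_op_scl[OF T]
      H.vector_space_axioms K.vector_space_axioms
    by (auto simp: bounded_op_def Vector_Spaces.linear_iff K.scale_right_distrib)
qed

lemma bounded_op_uminus:
  assumes T: "T \<in> bounded_op H K"
  shows "(\<lambda>x. - T x) \<in> bounded_op H K"
  using assms by (auto simp: bounded_op_def Vector_Spaces.linear_iff)

lemma hs_uminus:
  assumes "T \<in> hilbert_schmidt H K"
  shows "(\<lambda>x. - T x) \<in> hilbert_schmidt H K"
  using assms bounded_op_uminus by (auto simp: hilbert_schmidt_def)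

text \<open>Minkowski's inequality bounds all finite partial sums by one constant, which yields both
  summability and the triangle inequality.\<close>

lemma
  assumes S: "S \<in> hilbert_schmidt H K" and T: "T \<in> hilbert_schmidt H K"
  shows hs_plus: "(\<lambda>x. S x + T x) \<in> hilbert_schmidt H K"
    and hs_norm_triangle: "hs_norm H (\<lambda>x. S x + T x) \<le> hs_norm H S + hs_norm H T"
proof -
  obtain E where E: "is_onb H E"
    using H.onb_exists by blast
  let ?g = "\<lambda>e. (norm (S e + T e))\<^sup>2"
  let ?C = "hs_norm H S + hs_norm H T"
  have L2: "L2_set (\<lambda>e. norm (R e)) I \<le> hs_norm H R"
    if "R \<in> hilbert_schmidt H K" "finite I" "I \<subseteq> E" for R I
    unfolding L2_set_def
    using finite_sum_le_has_sum[OF hs_has_sum[OF that(1) E] that(2,3)]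
    by (intro real_le_lsqrt hs_norm_nonneg) (auto intro: sum_nonneg)
  have le: "sum ?g I \<le> ?C\<^sup>2" if I: "finite I" "I \<subseteq> E" for I
  proof -
    have "L2_set (\<lambda>e. norm (S e + T e)) I \<le> L2_set (\<lambda>e. norm (S e) + norm (T e)) I"
      by (intro L2_set_mono norm_triangle_ineq) auto
    also have "\<dots> \<le> ?C"
      using L2_set_triangle_ineq[of "\<lambda>e. norm (S e)" "\<lambda>e. norm (T e)" I] L2[OF S I] L2[OF T I]
      by linarith
    finally show ?thesis
      unfolding L2_set_def by (rule sqrt_le_D)
  qed
  have summ: "?g summable_on E"
    by (rule nonneg_bdd_above_summable_on) (use le in \<open>auto intro!: bdd_aboveI[of _ "?C\<^sup>2"]\<close>)
  have "S \<in> bounded_op H K" "T \<in> bounded_op H K"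
    using S T by (auto simp: hilbert_schmidt_def)
  then have hs: "(\<lambda>x. S x + T x) \<in> hilbert_schmidt H K"
    "(hs_norm H (\<lambda>x. S x + T x))\<^sup>2 = infsum ?g E"
    using hilbert_schmidtI[OF bounded_op_plus E has_sum_infsum[OF summ]] by auto
  show "(\<lambda>x. S x + T x) \<in> hilbert_schmidt H K"
    by (rule hs)
  show "hs_norm H (\<lambda>x. S x + T x) \<le> ?C"
  proof (rule power2_le_imp_le)
    show "(hs_norm H (\<lambda>x. S x + T x))\<^sup>2 \<le> ?C\<^sup>2"
      unfolding hs(2) by (rule infsum_le_finite_sums[OF summ le])
    show "0 \<le> ?C"
      by (intro add_nonneg_nonneg hs_norm_nonneg)
  qed
qed

lemma hs_minus:
  assumes "S \<in> hilbert_schmidt H K" "T \<in> hilbert_schmidt H K"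
  shows "(\<lambda>x. S x - T x) \<in> hilbert_schmidt H K"
  using hs_plus[OF assms(1) hs_uminus[OF assms(2)]] by simp

lemma
  shows hs_tensor: "tensor H K f e \<in> hilbert_schmidt H K"
    and hs_norm_tensor: "hs_norm H (tensor H K f e) = norm f * norm e"
proof -
  obtain E where E: "is_onb H E"
    using H.onb_exists by blast
  have "norm (tensor H K f e x) \<le> (norm f * norm e) * norm x" for x
    using mult_right_mono[OF H.Cauchy_Schwarz[of x e], of "norm f"]
    by (simp add: tensor_def K.norm_scl mult_ac)
  then have bd: "tensor H K f e \<in> bounded_op H K"
    using H.vector_space_axioms K.vector_space_axioms
    by (auto simp: bounded_op_def Vector_Spaces.linear_iff tensor_def H.ip_add_left H.ip_scl_left
        K.scale_left_distrib)
  have "((\<lambda>x. (norm f)\<^sup>2 * (norm (ip H e x))\<^sup>2) has_sum (norm f)\<^sup>2 * (norm e)\<^sup>2) E"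
    by (intro has_sum_cmult_right H.Parseval E)
  then have "((\<lambda>x. (norm (tensor H K f e x))\<^sup>2) has_sum (norm f * norm e)\<^sup>2) E"
    by (simp add: tensor_def K.norm_scl H.norm_ip_sym[of _ e] power_mult_distrib mult.commute)
  note hs = hilbert_schmidtI[OF bd E this]
  show "tensor H K f e \<in> hilbert_schmidt H K"
    by (rule hs)
  show "hs_norm H (tensor H K f e) = norm f * norm e"
    by (rule power2_eq_imp_eq[OF hs(2) hs_norm_nonneg]) simp
qed

lemma
  shows hs_zero: "(\<lambda>x. 0) \<in> hilbert_schmidt H K" and hs_norm_zero: "hs_norm H (\<lambda>x. 0 :: 'b) = 0"
  using hs_tensor[of 0 0] hs_norm_tensor[of 0 0] by (simp_all add: tensor_def[abs_def])

lemma
  assumes "\<And>i. i \<in> I \<Longrightarrow> T i \<in> hilbert_schmidt H K"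
  shows hs_sum: "(\<lambda>x. \<Sum>i\<in>I. T i x) \<in> hilbert_schmidt H K"
    and hs_norm_sum_le: "hs_norm H (\<lambda>x. \<Sum>i\<in>I. T i x) \<le> (\<Sum>i\<in>I. hs_norm H (T i))"
proof -
  have "(\<lambda>x. \<Sum>i\<in>I. T i x) \<in> hilbert_schmidt H K \<and>
    hs_norm H (\<lambda>x. \<Sum>i\<in>I. T i x) \<le> (\<Sum>i\<in>I. hs_norm H (T i))"
    using assms
  proof (induction I rule: infinite_finite_induct)
    case (insert i I)
    then have "(\<lambda>x. \<Sum>i\<in>I. T i x) \<in> hilbert_schmidt H K" "T i \<in> hilbert_schmidt H K"
      "hs_norm H (\<lambda>x. \<Sum>i\<in>I. T i x) \<le> (\<Sum>i\<in>I. hs_norm H (T i))"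
      by auto
    then show ?case
      using hs_plus[of "T i" "\<lambda>x. \<Sum>i\<in>I. T i x"] hs_norm_triangle[of "T i" "\<lambda>x. \<Sum>i\<in>I. T i x"]
        insert.hyps by auto
  qed (use hs_zero hs_norm_zero in auto)
  then show "(\<lambda>x. \<Sum>i\<in>I. T i x) \<in> hilbert_schmidt H K"
    "hs_norm H (\<lambda>x. \<Sum>i\<in>I. T i x) \<le> (\<Sum>i\<in>I. hs_norm H (T i))"
    by auto
qed

section \<open>Pythagoras for projected Hilbert-Schmidt operators\<close>

lemma
  assumes T: "T \<in> hilbert_schmidt H K" and V: "K.subspace V" "closed V"
  shows hs_proj_left: "proj K V \<circ> T \<in> hilbert_schmidt H K"
    and hs_norm_proj_left:
      "(hs_norm H T)\<^sup>2 = (hs_norm H (proj K V \<circ> T))\<^sup>2 + (hs_norm H (\<lambda>x. T x - proj K V (T x)))\<^sup>2"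
proof -
  obtain E where E: "is_onb H E"
    using H.onb_exists by blast
  have bT: "T \<in> bounded_op H K"
    using T by (simp add: hilbert_schmidt_def)
  have bPT: "proj K V \<circ> T \<in> bounded_op H K"
    by (rule bounded_op_comp[OF bT K.proj_bounded_op[OF V]])
  have sT: "((\<lambda>e. (norm (T e))\<^sup>2) has_sum (hs_norm H T)\<^sup>2) E"
    by (rule hs_has_sum[OF T E])
  have "(\<lambda>e. (norm ((proj K V \<circ> T) e))\<^sup>2) summable_on E"
    using K.norm_proj_le[OF V]
    by (intro summable_on_comparison_test[OF has_sum_imp_summable[OF sT]]) (auto intro: power_mono)
  from hilbert_schmidtI(1)[OF bPT E has_sum_infsum[OF this]]
  show PT: "proj K V \<circ> T \<in> hilbert_schmidt H K" .
  have D: "(\<lambda>x. T x - proj K V (T x)) \<in> hilbert_schmidt H K"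
    using hs_minus[OF T PT] by simp
  have "((\<lambda>e. (norm ((proj K V \<circ> T) e))\<^sup>2 + (norm (T e - proj K V (T e)))\<^sup>2) has_sum
    (hs_norm H (proj K V \<circ> T))\<^sup>2 + (hs_norm H (\<lambda>x. T x - proj K V (T x)))\<^sup>2) E"
    by (intro has_sum_add hs_has_sum PT D E)
  then show "(hs_norm H T)\<^sup>2 = (hs_norm H (proj K V \<circ> T))\<^sup>2 + (hs_norm H (\<lambda>x. T x - proj K V (T x)))\<^sup>2"
    using sT by (simp add: K.norm_proj_decomp[OF V, symmetric] has_sum_unique)
qed

text \<open>The two parts need not be orthogonal at a single basis vector. Their adjoints are
  \<open>proj H V \<circ> A\<close> and \<open>\<lambda>y. A y - proj H V (A y)\<close>, whose
  values are orthogonal at every vector, so the summation is carried out over a basis of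
  \<open>K\<close>.\<close>

lemma
  assumes T: "T \<in> hilbert_schmidt H K" and V: "H.subspace V" "closed V"
  shows hs_proj_right: "T \<circ> proj H V \<in> hilbert_schmidt H K"
    and hs_norm_proj_right:
      "(hs_norm H T)\<^sup>2 = (hs_norm H (T \<circ> proj H V))\<^sup>2 + (hs_norm H (\<lambda>x. T x - T (proj H V x)))\<^sup>2"
proof -
  interpret KH: hilbert_pair K H ..
  obtain E where E: "is_onb H E"
    using H.onb_exists by blast
  obtain F where F: "is_onb K F"
    using K.onb_exists by blast
  have bT: "T \<in> bounded_op H K"
    using T by (simp add: hilbert_schmidt_def)
  obtain A where A: "adjoint_pair H K T A"
    using adjoint_exists[OF bT] .
  have sA: "((\<lambda>f. (norm (A f))\<^sup>2) has_sum (hs_norm H T)\<^sup>2) F"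
    by (rule hs_sum_adjoint[OF A E F hs_has_sum[OF T E]])
  have adj: "adjoint_pair H K (T \<circ> proj H V) (proj H V \<circ> A)"
    "adjoint_pair H K (\<lambda>x. T x - T (proj H V x)) (\<lambda>y. A y - proj H V (A y))"
    using A by (auto simp: adjoint_pair_def H.ip_proj_left[OF V] H.ip_diff_right K.ip_diff_left)
  have bTP: "T \<circ> proj H V \<in> bounded_op H K"
    by (rule bounded_op_comp[OF H.proj_bounded_op[OF V] bT])
  have "(\<lambda>f. (norm ((proj H V \<circ> A) f))\<^sup>2) summable_on F"
    using H.norm_proj_le[OF V]
    by (intro summable_on_comparison_test[OF has_sum_imp_summable[OF sA]]) (auto intro: power_mono)
  from KH.hs_sum_adjoint[OF adjoint_pair_sym[OF adj(1)] F E has_sum_infsum[OF this]]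
  show TP: "T \<circ> proj H V \<in> hilbert_schmidt H K"
    using hilbert_schmidtI(1)[OF bTP E] by blast
  have D: "(\<lambda>x. T x - T (proj H V x)) \<in> hilbert_schmidt H K"
    using hs_minus[OF T TP] by simp
  have "((\<lambda>f. (norm ((proj H V \<circ> A) f))\<^sup>2 + (norm (A f - proj H V (A f)))\<^sup>2) has_sum
    (hs_norm H (T \<circ> proj H V))\<^sup>2 + (hs_norm H (\<lambda>x. T x - T (proj H V x)))\<^sup>2) F"
    by (intro has_sum_add hs_sum_adjoint[OF adj(1) E F] hs_sum_adjoint[OF adj(2) E F] hs_has_sum TP D E)
  then show "(hs_norm H T)\<^sup>2 = (hs_norm H (T \<circ> proj H V))\<^sup>2 + (hs_norm H (\<lambda>x. T x - T (proj H V x)))\<^sup>2"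
    using sA by (simp add: H.norm_proj_decomp[OF V, symmetric] has_sum_unique)
qed

text \<open>With P the projection onto \<open>W\<close>, the remainder T - R splits into T - P T and
  P T - R. The left rule is applied to T and to T - R, the right rule to P T.\<close>

lemma hs_norm_compression:
  assumes T: "T \<in> hilbert_schmidt H K" and V: "H.subspace V" "closed V" and W: "K.subspace W" "closed W"
  defines "R \<equiv> proj K W \<circ> T \<circ> proj H V"
  shows "R \<in> hilbert_schmidt H K"
    and "(hs_norm H T)\<^sup>2 = (hs_norm H R)\<^sup>2 + (hs_norm H (\<lambda>x. T x - R x))\<^sup>2"
proof -
  have PT: "proj K W \<circ> T \<in> hilbert_schmidt H K"
    by (rule hs_proj_left[OF T W])
  show R: "R \<in> hilbert_schmidt H K"
    unfolding R_def by (rule hs_proj_right[OF PT V])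
  let ?D = "\<lambda>x. T x - R x"
  have "proj K W (R x) = R x" for x
    by (rule K.proj_unique[OF W(1)])
      (simp_all add: R_def K.proj_mem[OF W] K.subspace_0[OF K.subspace_ocomp])
  then have "proj K W (T x - R x) = proj K W (T x) - R x" for x
    by (simp add: bounded_op_diff[OF K.proj_bounded_op[OF W]])
  then have "(hs_norm H ?D)\<^sup>2 = (hs_norm H (\<lambda>x. proj K W (T x) - R x))\<^sup>2 +
      (hs_norm H (\<lambda>x. T x - proj K W (T x)))\<^sup>2"
    using hs_norm_proj_left[OF hs_minus[OF T R] W] by (simp add: comp_def)
  moreover have "(hs_norm H (proj K W \<circ> T))\<^sup>2 =
      (hs_norm H R)\<^sup>2 + (hs_norm H (\<lambda>x. proj K W (T x) - R x))\<^sup>2"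
    using hs_norm_proj_right[OF PT V] by (simp add: R_def comp_def)
  ultimately show "(hs_norm H T)\<^sup>2 = (hs_norm H R)\<^sup>2 + (hs_norm H ?D)\<^sup>2"
    using hs_norm_proj_left[OF T W] by simp
qed

end

subsection \<open>Best approximation of bounded rank\<close>

lemma has_sum_finite_sum:
  fixes f :: "'i \<Rightarrow> 'a \<Rightarrow> 'b::topological_comm_monoid_add"
  assumes "\<And>i. i \<in> I \<Longrightarrow> (f i has_sum s i) A"
  shows "((\<lambda>x. \<Sum>i\<in>I. f i x) has_sum (\<Sum>i\<in>I. s i)) A"
  using assms by (induction I rule: infinite_finite_induct) (auto intro: has_sum_add)

text \<open>The squared norm is continuous, so the bound passes to the limit; estimates on an SVD
  series can thus be made on finite partial sums.\<close>

lemma has_sum_norm_sq_le: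
  fixes f :: "'i \<Rightarrow> 'a::real_normed_vector"
  assumes "(f has_sum S) A" and "\<And>I. finite I \<Longrightarrow> I \<subseteq> A \<Longrightarrow> (norm (sum f I))\<^sup>2 \<le> b"
  shows "(norm S)\<^sup>2 \<le> b"
proof (rule tendsto_upperbound)
  show "((\<lambda>I. (norm (sum f I))\<^sup>2) \<longlongrightarrow> (norm S)\<^sup>2) (finite_subsets_at_top A)"
    using assms(1) unfolding has_sum_def by (intro tendsto_intros)
  show "\<forall>\<^sub>F I in finite_subsets_at_top A. (norm (sum f I))\<^sup>2 \<le> b"
    using assms(2) by (intro eventually_finite_subsets_at_top_weakI) auto
qed auto

context hilbert_space
begin

text \<open>A finite value excludes the infinite branch of \<open>edim\<close>, and a basis inside
  \<open>V\<close> is then finite with \<open>dim V\<close> elements.\<close>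

lemma edim_leD:
  assumes "edim H V \<le> enat r"
  obtains b where "finite b" "card b \<le> r" "V \<subseteq> span b"
proof -
  obtain a where a: "finite a" "V \<subseteq> span a" and dim: "dim V \<le> r"
    using assms by (auto simp: edim_def split: if_splits)
  obtain b where b: "b \<subseteq> V" "independent b" "V \<subseteq> span b" "card b = dim V"
    by (rule basis_exists)
  have "finite b"
    using independent_span_bound[OF a(1) b(2)] a(2) b(1) by blast
  then show ?thesis
    using that[of b] b dim by simp
qed

lemma edim_leI:
  assumes "finite b" "card b \<le> r" "V \<subseteq> span b"
  shows "edim H V \<le> enat r"
  using assms dim_le_card[OF assms(3,1)] by (auto simp: edim_def)

text \<open>Double counting of |<e i, v>|^2 over \<open>I\<close> and an orthonormal
  \<open>V\<close> whose span contains that of \<open>b\<close>: each \<open>e i\<close> contributes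
  exactly 1, and each \<open>v\<close> at most 1 by Bessel.\<close>

lemma orthonormal_card_le:
  assumes e: "orthonormal_on H I e" and I: "finite I" and b: "finite b" "e ` I \<subseteq> span b"
  shows "card I \<le> card b"
proof -
  obtain V where V: "finite V" "card V \<le> card b" "orthonormal_on H V (\<lambda>x. x)" "span b \<subseteq> span V"
    by (rule orthonormal_spanning_set[OF b(1)])
  have unit: "(\<Sum>v\<in>V. (norm (ip H (e i) v))\<^sup>2) = 1" if "i \<in> I" for i
  proof -
    have "e i \<in> span V"
      using b(2) V(4) that by blast
    then have "fourier_sum V (\<lambda>x. x) (e i) = e i"
      by (intro fourier_sum_eq V) simp
    then show ?thesis
      using Bessel_identity[OF V(3,1), of "e i"] orthonormal_norm[OF e that] by simp
  qed
  have "real (card I) = (\<Sum>i\<in>I. 1)"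
    by simp
  also have "\<dots> = (\<Sum>i\<in>I. \<Sum>v\<in>V. (norm (ip H (e i) v))\<^sup>2)"
    using unit by (intro sum.cong) auto
  also have "\<dots> = (\<Sum>v\<in>V. \<Sum>i\<in>I. (norm (ip H v (e i)))\<^sup>2)"
    by (subst sum.swap) (simp add: norm_ip_sym[of "e _"])
  also have "\<dots> \<le> (\<Sum>v\<in>V. 1)"
    using Bessel_inequality[OF e I] orthonormal_norm[OF V(3)]
    by (intro sum_mono) (metis one_power2)
  finally show ?thesis
    using V(2) by simp
qed

end

section \<open>Singular value decompositions and truncation\<close>

context hilbert_pair
begin

lemma scaleR_tensor: "a *\<^sub>R tensor H K f e x = tensor H K (a *\<^sub>R f) e x"
  by (simp add: tensor_def K.scl_scaleR)

lemma hs_tensor_sum: "(\<lambda>x. \<Sum>i\<in>I. a i *\<^sub>R tensor H K (f i) (e i) x) \<in> hilbert_schmidt H K"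
  unfolding scaleR_tensor by (intro hs_sum hs_tensor)

lemma svd_has_sum:
  assumes "is_svd H K T N \<sigma> f e"
  shows "((\<lambda>i. \<sigma> i *\<^sub>R tensor H K (f i) (e i) h) has_sum T h) {i. enat i < N}"
  using assms by (simp add: is_svd_def)

text \<open>Pairing with \<open>f i\<close> is continuous, hence can be done term by term, and
  orthonormality leaves one term.\<close>

lemma svd_coefficient:
  assumes svd: "is_svd H K T N \<sigma> f e" and i: "enat i < N"
  shows "ip K (T h) (f i) = \<sigma> i *\<^sub>R ip H h (e i)"
proof -
  let ?I = "{i. enat i < N}"
  have f: "ip K (f j) (f i) = (if j = i then 1 else 0)" if "j \<in> ?I" for j
    using svd i that by (simp add: is_svd_def orthonormal_on_def)
  have "((\<lambda>j. ip K (\<sigma> j *\<^sub>R tensor H K (f j) (e j) h) (f i)) has_sum ip K (T h) (f i)) ?I"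
    by (rule has_sum_bounded_linear[OF K.bounded_linear_ip_left svd_has_sum[OF svd]])
  moreover have "((\<lambda>j. ip K (\<sigma> j *\<^sub>R tensor H K (f j) (e j) h) (f i)) has_sum \<sigma> i *\<^sub>R ip H h (e i)) ?I"
    using i by (intro has_sum_finite_neutralI[of "{i}"])
      (auto simp: tensor_def K.ip_scaleR_left K.ip_scl_left f)
  ultimately show ?thesis
    by (rule has_sum_unique)
qed

lemma svd_image:
  assumes svd: "is_svd H K T N \<sigma> f e" and i: "enat i < N"
  shows "T (e i) = \<sigma> i *\<^sub>R f i"
proof -
  let ?I = "{i. enat i < N}"
  have e: "ip H (e i) (e j) = (if i = j then 1 else 0)" if "j \<in> ?I" for j
    using svd i that by (simp add: is_svd_def orthonormal_on_def)
  have "((\<lambda>j. \<sigma> j *\<^sub>R tensor H K (f j) (e j) (e i)) has_sum \<sigma> i *\<^sub>R f i) ?I"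
    using i by (intro has_sum_finite_neutralI[of "{i}"]) (auto simp: tensor_def e)
  then show ?thesis
    using svd_has_sum[OF svd] has_sum_unique by blast
qed

text \<open>If the rank \<open>d\<close> were smaller than \<open>N\<close>, the
  \<open>d + 1\<close> orthonormal vectors \<open>f 0\<close>, ..., \<open>f d\<close>, each a
  multiple of a value of \<open>T\<close>, would lie in the span of at most \<open>d\<close>
  vectors.\<close>

lemma svd_rank:
  assumes svd: "is_svd H K T N \<sigma> f e"
  shows "edim K (range T) = N"
proof (rule antisym)
  show "edim K (range T) \<le> N"
  proof (cases N)
    case (enat n)
    have "T h \<in> K.span (f ` {..<n})" for h
    proof -
      have "T h = (\<Sum>i<n. \<sigma> i *\<^sub>R tensor H K (f i) (e i) h)"
        using svd_has_sum[OF svd, of h] by (simp add: enat has_sum_finite_iff lessThan_def)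
      also have "\<dots> \<in> K.span (f ` {..<n})"
        unfolding tensor_def by (intro K.span_sum) (metis K.scl_of_real K.span_base K.span_scale imageI)
      finally show ?thesis .
    qed
    then have "range T \<subseteq> K.span (f ` {..<n})"
      by blast
    moreover have "card (f ` {..<n}) \<le> n"
      using card_image_le[of "{..<n}" f] by simp
    ultimately show ?thesis
      using K.edim_leI[of "f ` {..<n}" n "range T"] by (simp add: enat)
  qed simp
next
  show "N \<le> edim K (range T)"
  proof (rule ccontr)
    assume "\<not> N \<le> edim K (range T)"
    then obtain d where d: "edim K (range T) = enat d" "enat d < N"
      by (cases "edim K (range T)") auto
    obtain b where b: "finite b" "card b \<le> d" "range T \<subseteq> K.span b"
      using K.edim_leD[of "range T" d] d(1) by auto
    have lt: "enat i < N" if "i \<in> {..<Suc d}" for i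
      using that d(2) by (metis enat_ord_simps(1) le_less_trans less_Suc_eq_le lessThan_iff)
    have "f i \<in> K.span b" if "i \<in> {..<Suc d}" for i
    proof -
      have "\<sigma> i \<noteq> 0"
        using svd lt[OF that] by (auto simp: is_svd_def)
      then have "f i = scl K (of_real (1 / \<sigma> i)) (T (e i))"
        unfolding K.scl_of_real using svd_image[OF svd lt[OF that]] by simp
      then show ?thesis
        using b(3) by (simp add: K.span_scale subset_iff)
    qed
    moreover have "orthonormal_on K {..<Suc d} f"
      using svd lt by (auto simp: is_svd_def intro: K.orthonormal_on_subset)
    ultimately have "card {..<Suc d} \<le> card b"
      using b(1) by (intro K.orthonormal_card_le[of "{..<Suc d}" f]) auto
    then show False
      using b(2) by simp
  qed
qed

text \<open>Meant for \<open>h\<close> equal to the adjoint at \<open>v\<close>, where it bounds the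
  adjoint without an SVD of its own. On finite partial sums Cauchy-Schwarz separates
  \<open>h\<close> from \<open>v\<close>; subtracting the threshold \<open>\<mu>\<^sup>2\<close>
  from the squared singular values leaves indices from \<open>s\<close> on to Bessel for
  \<open>v\<close>.\<close>

lemma svd_form_bound:
  fixes v :: 'b
  assumes svd: "is_svd H K T N \<sigma> f e" and s: "enat s \<le> N"
    and \<mu>: "\<And>i. i < s \<Longrightarrow> \<mu> \<le> \<sigma> i" "\<And>i. s \<le> i \<Longrightarrow> enat i < N \<Longrightarrow> \<sigma> i \<le> \<mu>" "\<mu> \<ge> 0"
  defines "c \<equiv> (\<Sum>i<s. ((\<sigma> i)\<^sup>2 - \<mu>\<^sup>2) * (norm (ip K v (f i)))\<^sup>2) + \<mu>\<^sup>2 * (norm v)\<^sup>2"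
  shows "(norm (ip K (T h) v))\<^sup>2 \<le> (norm h)\<^sup>2 * c"
proof (rule has_sum_norm_sq_le)
  show "((\<lambda>i. ip K (\<sigma> i *\<^sub>R tensor H K (f i) (e i) h) v) has_sum ip K (T h) v) {i. enat i < N}"
    by (rule has_sum_bounded_linear[OF K.bounded_linear_ip_left svd_has_sum[OF svd]])
next
  fix I assume I: "finite I" "I \<subseteq> {i. enat i < N}"
  have e: "orthonormal_on H I e" and f: "orthonormal_on K I f"
    using svd I(2) by (auto simp: is_svd_def intro: H.orthonormal_on_subset K.orthonormal_on_subset)
  have pos: "\<sigma> i > 0" if "enat i < N" for i
    using svd that by (simp add: is_svd_def)
  define a where "a i = (norm (ip K v (f i)))\<^sup>2" for i
  have sq: "\<mu>\<^sup>2 \<le> (\<sigma> i)\<^sup>2" if "i < s" for i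
    using \<mu> that by (intro power_mono) auto
  have "(\<Sum>i\<in>I. (\<sigma> i)\<^sup>2 * a i) = (\<Sum>i\<in>I. ((\<sigma> i)\<^sup>2 - \<mu>\<^sup>2) * a i) + \<mu>\<^sup>2 * (\<Sum>i\<in>I. a i)"
    by (simp add: left_diff_distrib sum_subtractf sum_distrib_left)
  also have "(\<Sum>i\<in>I. ((\<sigma> i)\<^sup>2 - \<mu>\<^sup>2) * a i) \<le> (\<Sum>i\<in>I \<inter> {..<s}. ((\<sigma> i)\<^sup>2 - \<mu>\<^sup>2) * a i)"
  proof -
    have "((\<sigma> i)\<^sup>2 - \<mu>\<^sup>2) * a i \<le> 0" if "i \<in> I - {..<s}" for i
    proof -
      have "\<sigma> i \<le> \<mu>" "\<sigma> i \<ge> 0"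
        using that I(2) \<mu>(2)[of i] pos[of i] by auto
      then show ?thesis
        by (intro mult_nonpos_nonneg) (auto simp: a_def intro: power_mono)
    qed
    then have "(\<Sum>i\<in>I - {..<s}. ((\<sigma> i)\<^sup>2 - \<mu>\<^sup>2) * a i) \<le> 0"
      by (rule sum_nonpos)
    then show ?thesis
      using I(1) by (subst sum.Int_Diff[of _ _ "{..<s}"]) auto
  qed
  \<comment> \<open>Below \<open>s\<close> the weights are nonnegative, so the indices missing from
    \<open>I\<close> can be added.\<close>
  also have "\<dots> \<le> (\<Sum>i<s. ((\<sigma> i)\<^sup>2 - \<mu>\<^sup>2) * a i)"
    using sq by (intro sum_mono2) (auto simp: a_def)
  also have "(\<Sum>i\<in>I. a i) \<le> (norm v)\<^sup>2"
    unfolding a_def by (rule K.Bessel_inequality[OF f I(1)])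
  finally have c: "(\<Sum>i\<in>I. (\<sigma> i)\<^sup>2 * a i) \<le> c"
    by (simp add: c_def a_def mult_left_mono)
  have "norm (\<Sum>i\<in>I. ip K (\<sigma> i *\<^sub>R tensor H K (f i) (e i) h) v)
      \<le> (\<Sum>i\<in>I. norm (ip H h (e i)) * (\<sigma> i * norm (ip K v (f i))))"
  proof (rule sum_norm_le)
    fix i assume "i \<in> I"
    then have "\<sigma> i > 0"
      using I(2) pos by auto
    then show "norm (ip K (\<sigma> i *\<^sub>R tensor H K (f i) (e i) h) v)
        \<le> norm (ip H h (e i)) * (\<sigma> i * norm (ip K v (f i)))"
      by (simp add: tensor_def K.ip_scaleR_left K.ip_scl_left norm_mult K.norm_ip_sym[of "f i"])
  qed
  then have "(norm (\<Sum>i\<in>I. ip K (\<sigma> i *\<^sub>R tensor H K (f i) (e i) h) v))\<^sup>2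
      \<le> (\<Sum>i\<in>I. norm (ip H h (e i)) * (\<sigma> i * norm (ip K v (f i))))\<^sup>2"
    by (rule power_mono) simp
  also have "\<dots> \<le> (\<Sum>i\<in>I. (norm (ip H h (e i)))\<^sup>2) * (\<Sum>i\<in>I. (\<sigma> i * norm (ip K v (f i)))\<^sup>2)"
    by (rule Cauchy_Schwarz_ineq_sum)
  also have "\<dots> \<le> (norm h)\<^sup>2 * c"
    using c by (intro mult_mono H.Bessel_inequality[OF e I(1)])
      (auto simp: a_def power_mult_distrib intro: sum_nonneg)
  finally show "(norm (\<Sum>i\<in>I. ip K (\<sigma> i *\<^sub>R tensor H K (f i) (e i) h) v))\<^sup>2 \<le> (norm h)\<^sup>2 * c" .
qed

text \<open>Both squared errors are |T|^2 minus what a projection captures of the values of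
  \<open>T\<close>: exactly so for the truncation, which projects onto the span of the first
  \<open>s\<close> vectors of \<open>f\<close>, and at best for \<open>R\<close>, whose values lie
  in the span of \<open>V\<close>. It remains to compare the captured amounts.\<close>

theorem Eckart_Young_Mirsky:
  assumes T: "T \<in> hilbert_schmidt H K" and svd: "is_svd H K T N \<sigma> f e"
    and s: "enat s \<le> N" "s = r \<or> N = enat s" "s \<le> r"
    and R: "R \<in> hilbert_schmidt H K" and b: "finite b" "card b \<le> r" "range R \<subseteq> K.span b"
  shows "hs_norm H (\<lambda>x. T x - (\<Sum>i<s. \<sigma> i *\<^sub>R tensor H K (f i) (e i) x)) \<le> hs_norm H (\<lambda>x. T x - R x)"
proof -
  define Y where "Y x = (\<Sum>i<s. \<sigma> i *\<^sub>R tensor H K (f i) (e i) x)" for x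
  obtain V where V: "finite V" "card V \<le> card b" "orthonormal_on K V (\<lambda>x. x)" "K.span b \<subseteq> K.span V"
    by (rule K.orthonormal_spanning_set[OF b(1)])
  have cV: "card V \<le> r"
    using V b by simp
  obtain E where E: "is_onb H E"
    using H.onb_exists by blast
  obtain A where A: "adjoint_pair H K T A"
    using adjoint_exists[of T] T by (auto simp: hilbert_schmidt_def)
  have sN: "enat i < N" if "i < s" for i
    using that s(1) by (metis enat_ord_simps(2) less_le_trans)
  then have f: "orthonormal_on K {..<s} f" and e: "orthonormal_on H {..<s} e"
    using svd by (auto simp: is_svd_def intro: H.orthonormal_on_subset K.orthonormal_on_subset)
  have pos: "\<sigma> i > 0" if "enat i < N" for i
    using svd that by (simp add: is_svd_def)
  have dec: "\<sigma> j \<le> \<sigma> i" if "i \<le> j" "enat j < N" for i j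
    using svd that by (simp add: is_svd_def)
  \<comment> \<open>\<open>\<mu>\<close> separates the kept singular values from the discarded ones. The squared norm of the
    projection of \<open>T\<close> to \<open>span V\<close> is \<open>\<Sum>v\<in>V. \<bar>A v\<bar>\<^sup>2\<close>; splitting \<open>\<sigma>\<^sub>i\<^sup>2\<close> into
    \<open>\<sigma>\<^sub>i\<^sup>2 - \<mu>\<^sup>2\<close> and \<open>\<mu>\<^sup>2\<close> bounds it by \<open>\<Sum>i<s. \<sigma>\<^sub>i\<^sup>2\<close> with two uses of Bessel.\<close>
  obtain \<mu> where \<mu>: "\<And>i. i < s \<Longrightarrow> \<mu> \<le> \<sigma> i" "\<And>i. s \<le> i \<Longrightarrow> enat i < N \<Longrightarrow> \<sigma> i \<le> \<mu>" "\<mu> \<ge> 0"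
    and \<mu>r: "\<mu> = 0 \<or> s = r"
  proof (cases "N = enat s")
    case True
    then show ?thesis
      using that[of 0] pos[OF sN] by (force intro: less_imp_le)
  next
    case False
    \<comment> \<open>Something is discarded, so \<open>s = r\<close>, and the smallest kept
      singular value serves as \<mu>. For \<open>s = 0\<close> the truncated subtraction selects
      \<open>\<sigma> 0\<close>, which bounds all discarded ones.\<close>
    have "enat (s - 1) < N"
      using False s(1) by (metis diff_le_self enat_ord_simps(1) le_less_trans order_le_less)
    then show ?thesis
      using that[of "\<sigma> (s - 1)"] False s(2) pos dec sN by (auto intro: less_imp_le)
  qed
  \<comment> \<open>The form bound at \<open>h = A v\<close>, where its left side is |A v|^4; the
    case \<open>A v = 0\<close> is set apart because a factor |A v|^2 is cancelled.\<close>
  have Av: "(norm (A v))\<^sup>2 \<le> (\<Sum>i<s. ((\<sigma> i)\<^sup>2 - \<mu>\<^sup>2) * (norm (ip K v (f i)))\<^sup>2) + \<mu>\<^sup>2 * (norm v)\<^sup>2"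
    (is "_ \<le> ?c v") for v
  proof (cases "A v = 0")
    case True
    have "\<mu>\<^sup>2 \<le> (\<sigma> i)\<^sup>2" if "i < s" for i
      using \<mu> that by (intro power_mono) auto
    then have "0 \<le> ?c v"
      by (intro add_nonneg_nonneg sum_nonneg mult_nonneg_nonneg) auto
    then show ?thesis
      using True by simp
  next
    case False
    have "ip K (T (A v)) v = of_real ((norm (A v))\<^sup>2)"
      using A by (simp add: adjoint_pair_def H.ip_norm)
    then have "norm (ip K (T (A v)) v) = (norm (A v))\<^sup>2"
      by (simp only: norm_of_real) simp
    then have "(norm (A v))\<^sup>2 * (norm (A v))\<^sup>2 \<le> (norm (A v))\<^sup>2 * ?c v"
      using svd_form_bound[OF svd s(1) \<mu>, of "A v" v] by (simp only: power2_eq_square)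
    moreover have "(norm (A v))\<^sup>2 > 0"
      using False by simp
    ultimately show ?thesis
      by (simp only: mult_le_cancel_left_pos)
  qed
  have "(\<Sum>v\<in>V. (norm (A v))\<^sup>2) \<le> (\<Sum>v\<in>V. ?c v)"
    by (intro sum_mono Av)
  also have "\<dots> = (\<Sum>i<s. ((\<sigma> i)\<^sup>2 - \<mu>\<^sup>2) * (\<Sum>v\<in>V. (norm (ip K (f i) v))\<^sup>2)) + \<mu>\<^sup>2 * real (card V)"
  proof -
    have "(\<Sum>v\<in>V. \<Sum>i<s. ((\<sigma> i)\<^sup>2 - \<mu>\<^sup>2) * (norm (ip K v (f i)))\<^sup>2)
        = (\<Sum>i<s. ((\<sigma> i)\<^sup>2 - \<mu>\<^sup>2) * (\<Sum>v\<in>V. (norm (ip K (f i) v))\<^sup>2))"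
      by (subst sum.swap) (simp add: sum_distrib_left K.norm_ip_sym[of "f _"])
    then show ?thesis
      using K.orthonormal_norm[OF V(3)] by (simp add: sum.distrib)
  qed
  also have "\<dots> \<le> (\<Sum>i<s. ((\<sigma> i)\<^sup>2 - \<mu>\<^sup>2) * 1) + \<mu>\<^sup>2 * real r"
  proof (intro add_mono sum_mono mult_left_mono)
    fix i assume "i \<in> {..<s}"
    then show "(\<Sum>v\<in>V. (norm (ip K (f i) v))\<^sup>2) \<le> 1"
      using K.Bessel_inequality[OF V(3,1), of "f i"] K.orthonormal_norm[OF f] by simp
    show "0 \<le> (\<sigma> i)\<^sup>2 - \<mu>\<^sup>2"
      using \<mu>(1)[of i] \<mu>(3) \<open>i \<in> {..<s}\<close> by (simp add: power_mono)
  qed (use cV in auto)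
  \<comment> \<open>The surplus, \<mu> squared times \<open>r - s\<close>, vanishes because \<mu> =
    0 or \<open>s = r\<close>.\<close>
  also have "\<dots> = (\<Sum>i<s. (\<sigma> i)\<^sup>2)"
    using \<mu>r by (auto simp: sum_subtractf)
  finally have gap: "(\<Sum>v\<in>V. (norm (A v))\<^sup>2) \<le> (\<Sum>i<s. (\<sigma> i)\<^sup>2)" .
  have sT: "((\<lambda>x. (norm (T x))\<^sup>2) has_sum (hs_norm H T)\<^sup>2) E"
    by (rule hs_has_sum[OF T E])
  \<comment> \<open>Each term is the squared distance from \<open>T x\<close> to the span of
    \<open>V\<close>; the subtracted part sums to |A v|^2 for each \<open>v\<close> by
    Parseval.\<close>
  have sV: "((\<lambda>x. (norm (T x))\<^sup>2 - (\<Sum>v\<in>V. (norm (ip K (T x) v))\<^sup>2)) has_sum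
      (hs_norm H T)\<^sup>2 - (\<Sum>v\<in>V. (norm (A v))\<^sup>2)) E"
  proof -
    have "((\<lambda>x. (norm (ip K (T x) v))\<^sup>2) has_sum (norm (A v))\<^sup>2) E" for v
      using H.Parseval[OF E, of "A v"] A by (simp add: adjoint_pair_def H.norm_ip_sym[of "A v"])
    then have "((\<lambda>x. \<Sum>v\<in>V. (norm (ip K (T x) v))\<^sup>2) has_sum (\<Sum>v\<in>V. (norm (A v))\<^sup>2)) E"
      by (rule has_sum_finite_sum)
    from has_sum_add[OF sT has_sum_uminusI[OF this]] show ?thesis
      by simp
  qed
  have sY: "((\<lambda>x. (norm (T x - Y x))\<^sup>2) has_sum (hs_norm H T)\<^sup>2 - (\<Sum>i<s. (\<sigma> i)\<^sup>2)) E"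
  proof -
    have "((\<lambda>x. (norm (ip K (T x) (f i)))\<^sup>2) has_sum (\<sigma> i)\<^sup>2) E" if "i \<in> {..<s}" for i
    proof -
      have "((\<lambda>x. (\<sigma> i)\<^sup>2 * (norm (ip H (e i) x))\<^sup>2) has_sum (\<sigma> i)\<^sup>2 * (norm (e i))\<^sup>2) E"
        by (intro has_sum_cmult_right H.Parseval E)
      then show ?thesis
        using svd_coefficient[OF svd sN[of i]] that H.orthonormal_norm[OF e]
        by (simp add: H.norm_ip_sym[of "e i"] power_mult_distrib)
    qed
    then have "((\<lambda>x. \<Sum>i<s. (norm (ip K (T x) (f i)))\<^sup>2) has_sum (\<Sum>i<s. (\<sigma> i)\<^sup>2)) E"
      by (rule has_sum_finite_sum)
    from has_sum_add[OF sT has_sum_uminusI[OF this]]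
    have "((\<lambda>x. (norm (T x))\<^sup>2 - (\<Sum>i<s. (norm (ip K (T x) (f i)))\<^sup>2)) has_sum
        (hs_norm H T)\<^sup>2 - (\<Sum>i<s. (\<sigma> i)\<^sup>2)) E"
      by simp
    moreover have "Y x = K.fourier_sum {..<s} f (T x)" for x
      unfolding Y_def K.fourier_sum_def using svd_coefficient[OF svd sN]
      by (intro sum.cong refl)
        (simp add: tensor_def scaleR_conv_of_real flip: K.scl_of_real)
    then have "(norm (T x - Y x))\<^sup>2 = (norm (T x))\<^sup>2 - (\<Sum>i<s. (norm (ip K (T x) (f i)))\<^sup>2)" for x
      using K.Bessel_identity[OF f, of "T x"] by simp
    ultimately show ?thesis
      by simp
  qed
  have Y: "Y \<in> hilbert_schmidt H K"
    unfolding Y_def[abs_def] by (rule hs_tensor_sum)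
  have "(hs_norm H (\<lambda>x. T x - Y x))\<^sup>2 = (hs_norm H T)\<^sup>2 - (\<Sum>i<s. (\<sigma> i)\<^sup>2)"
    by (rule has_sum_unique[OF hs_has_sum[OF hs_minus[OF T Y] E] sY])
  also have "\<dots> \<le> (hs_norm H T)\<^sup>2 - (\<Sum>v\<in>V. (norm (A v))\<^sup>2)"
    using gap by simp
  also have "\<dots> \<le> (hs_norm H (\<lambda>x. T x - R x))\<^sup>2"
  proof (rule has_sum_mono[OF sV hs_has_sum[OF hs_minus[OF T R] E]])
    fix x
    have "R x \<in> K.span ((\<lambda>x. x) ` V)"
      using b(3) V(4) by auto
    from K.fourier_sum_best_approximation[OF V(3,1) this, of "T x"]
    have "(norm (T x - K.fourier_sum V (\<lambda>x. x) (T x)))\<^sup>2 \<le> (norm (T x - R x))\<^sup>2"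
      by (intro power_mono) auto
    then show "(norm (T x))\<^sup>2 - (\<Sum>v\<in>V. (norm (ip K (T x) v))\<^sup>2) \<le> (norm (T x - R x))\<^sup>2"
      using K.Bessel_identity[OF V(3,1), of "T x"] by simp
  qed
  finally show ?thesis
    unfolding Y_def by (rule power2_le_imp_le[OF _ hs_norm_nonneg])
qed

section \<open>Kernels, ranges and the Moore-Penrose inverse\<close>

lemma
  assumes T: "T \<in> bounded_op H K"
  shows subspace_kern: "H.subspace (kern T)" and closed_kern: "closed (kern T)"
    and subspace_range: "K.subspace (range T)"
proof -
  show "H.subspace (kern T)"
    by (rule H.subspaceI) (auto simp: bounded_op_zero[OF T] bounded_op_add[OF T] bounded_op_scl[OF T])
  show "K.subspace (range T)"
  proof (rule K.subspaceI)
    show "0 \<in> range T"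
      by (rule range_eqI[of _ _ 0]) (simp add: bounded_op_zero[OF T])
    fix x y c assume "x \<in> range T" "y \<in> range T"
    then obtain a b where ab: "x = T a" "y = T b"
      by blast
    show "x + y \<in> range T"
      by (rule range_eqI[of _ _ "a + b"]) (simp add: ab bounded_op_add[OF T])
    show "scl K c x \<in> range T"
      by (rule range_eqI[of _ _ "scl H c a"]) (simp add: ab bounded_op_scl[OF T])
  qed
  obtain c where c: "\<And>x. norm (T x) \<le> c * norm x"
    using T by (meson bounded_op_bound)
  have "bounded_linear T"
    by (rule bounded_linear_intro[where K = c])
      (use c in \<open>auto simp: bounded_op_add[OF T] bounded_op_scl[OF T] mult.commute
        simp flip: H.scl_of_real K.scl_of_real\<close>)
  then show "closed (kern T)"
    by (intro closed_Collect_eq linear_continuous_on continuous_on_const)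
qed

text \<open>The projection changes \<open>x\<close> by a vector of the kernel.\<close>

lemma proj_coimage:
  assumes T: "T \<in> bounded_op H K"
  shows "T (proj H (ocomp H (kern T)) x) = T x"
  using H.proj_mem[OF subspace_kern[OF T] closed_kern[OF T], of x]
  by (simp add: H.proj_ocomp[OF subspace_kern[OF T] closed_kern[OF T]] bounded_op_diff[OF T])

lemma inj_on_coimage:
  assumes T: "T \<in> bounded_op H K"
  shows "inj_on T (ocomp H (kern T))"
proof (rule inj_onI)
  fix x y assume xy: "x \<in> ocomp H (kern T)" "y \<in> ocomp H (kern T)" "T x = T y"
  then have "x - y \<in> ocomp H (kern T)" "x - y \<in> kern T"
    by (auto intro: H.subspace_diff[OF H.subspace_ocomp] simp: bounded_op_diff[OF T])
  then have "ip H (x - y) (x - y) = 0"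
    by (auto simp only: ocomp_def)
  then show "x = y"
    by simp
qed

text \<open>The range meets its orthogonal complement only in 0, so the range part of the argument
  is determined and the definite description has a single candidate.\<close>

lemma mp_inverse_eq:
  assumes T: "T \<in> bounded_op H K" and x: "x \<in> ocomp H (kern T)" and k: "k \<in> ocomp K (range T)"
  shows "mp_inverse H K T (T x + k) = Some x"
proof -
  have inv: "inv_into (ocomp H (kern T)) T (T x) = x"
    by (rule inv_into_f_f[OF inj_on_coimage[OF T] x])
  have "(THE z. \<exists>h\<in>range T. \<exists>k'\<in>ocomp K (range T). T x + k = h + k' \<and>
      z = inv_into (ocomp H (kern T)) T h) = x"
  proof (rule the_equality)
    show "\<exists>h\<in>range T. \<exists>k'\<in>ocomp K (range T). T x + k = h + k' \<and> x = inv_into (ocomp H (kern T)) T h"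
      using inv k by (intro bexI[of _ "T x"] bexI[of _ k]) auto
  next
    fix z assume "\<exists>h\<in>range T. \<exists>k'\<in>ocomp K (range T). T x + k = h + k' \<and>
      z = inv_into (ocomp H (kern T)) T h"
    then obtain h k' where h: "h \<in> range T" "k' \<in> ocomp K (range T)" "T x + k = h + k'"
      "z = inv_into (ocomp H (kern T)) T h"
      by blast
    have "h - T x = k - k'"
      using h(3) by (simp add: algebra_simps)
    moreover have "k - k' \<in> ocomp K (range T)"
      by (rule K.subspace_diff[OF K.subspace_ocomp k h(2)])
    moreover have "h - T x \<in> range T"
      by (rule K.subspace_diff[OF subspace_range[OF T] h(1) rangeI])
    ultimately have "h - T x \<in> ocomp K (range T)" "h - T x \<in> range T"
      by simp_all
    then have "ip K (h - T x) (h - T x) = 0"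
      unfolding ocomp_def by blast
    then show "z = x"
      using h(4) inv by simp
  qed
  moreover have "\<exists>h\<in>range T. \<exists>k'\<in>ocomp K (range T). T x + k = h + k'"
    using k by blast
  ultimately show ?thesis
    by (simp only: mp_inverse_def if_True)
qed

text \<open>Any preimage may be replaced by its projection, which has the same image by
  \<open>proj_coimage\<close>.\<close>

lemma dom_mp_inverseE:
  assumes T: "T \<in> bounded_op H K" and y: "y \<in> dom (mp_inverse H K T)"
  obtains x k where "x \<in> ocomp H (kern T)" "k \<in> ocomp K (range T)" "y = T x + k"
proof -
  obtain x k where "k \<in> ocomp K (range T)" "y = T x + k"
    using y by (auto simp: mp_inverse_def dom_def split: if_splits)
  then show ?thesis
    using that[of "proj H (ocomp H (kern T)) x" k] H.proj_ocomp_mem proj_coimage[OF T] by simp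
qed

lemma dom_mp_inverseI:
  assumes "k \<in> ocomp K (range T)"
  shows "T x + k \<in> dom (mp_inverse H K T)"
  using assms by (auto simp: mp_inverse_def dom_def)

lemma mp_inverse_image:
  assumes T: "T \<in> bounded_op H K" and x: "x \<in> ocomp H (kern T)"
  shows "mp_inverse H K T (T x) = Some x"
  using mp_inverse_eq[OF T x, of 0] K.subspace_0[OF K.subspace_ocomp] by simp

lemma range_subset_dom_mp_inverse: "T x \<in> dom (mp_inverse H K T)"
  using dom_mp_inverseI[of 0 T x] K.subspace_0[OF K.subspace_ocomp] by simp

end

subsection \<open>The constrained problem\<close>

locale low_rank_problem =
  H1: hilbert_space H1 + H2: hilbert_space H2 + H3: hilbert_space H3 + H4: hilbert_space H4
  for H1 :: "('k::rc_field, 'h1::banach) hilbert" and H2 :: "('k, 'h2::banach) hilbert"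
    and H3 :: "('k, 'h3::banach) hilbert" and H4 :: "('k, 'h4::banach) hilbert" +
  fixes B :: "'h3 \<Rightarrow> 'h4" and C :: "'h1 \<Rightarrow> 'h2"
  assumes B: "B \<in> bounded_op H3 H4" and C: "C \<in> bounded_op H1 H2"
begin

sublocale H14: hilbert_pair H1 H4 ..
sublocale H12: hilbert_pair H1 H2 ..
sublocale H34: hilbert_pair H3 H4 ..

text \<open>The algebraic half of the construction, for arbitrary left factors in ran B; their
  closeness to the singular vectors enters in \<open>residual_upper_bound\<close>.\<close>

lemma approximant:
  fixes lam :: "nat \<Rightarrow> real"
  assumes s: "s \<le> r" and e: "\<And>i. i < s \<Longrightarrow> e i \<in> ocomp H1 (kern C)"
    and g: "\<And>i. i < s \<Longrightarrow> g i \<in> range B"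
  defines "Y \<equiv> (\<lambda>h. \<Sum>i<s. lam i *\<^sub>R tensor H1 H4 (g i) (e i) h)"
  defines "X \<equiv> mp_inverse H3 H4 B \<circ>\<^sub>m tot Y \<circ>\<^sub>m mp_inverse H1 H2 C"
  shows "X \<in> feasible_ops H1 H2 H3 H4 B C r"
    and "dom X = dom (mp_inverse H1 H2 C)"
    and "y \<in> dom (mp_inverse H1 H2 C) \<Longrightarrow>
      X y = (tot (proj H3 (ocomp H3 (kern B))) \<circ>\<^sub>m X \<circ>\<^sub>m tot (proj H2 (closure (range C)))) y"
    and "tot B \<circ>\<^sub>m X \<circ>\<^sub>m tot C = tot Y"
proof -
  \<comment> \<open>\<open>inv\<close> picks some preimage; for \<open>i < s\<close>, removing its
    kernel part gives the value of the pseudoinverse of \<open>B\<close> at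
    \<open>g i\<close>.\<close>
  define b where "b i = proj H3 (ocomp H3 (kern B)) (inv B (g i))" for i
  have b: "b i \<in> ocomp H3 (kern B)" for i
    unfolding b_def by (rule H3.proj_ocomp_mem)
  have Bb: "B (b i) = g i" if "i < s" for i
    using g[OF that] by (simp add: b_def H34.proj_coimage[OF B] f_inv_into_f)
  \<comment> \<open>The pseudoinverse of \<open>B\<close> at \<open>Y x\<close>, as an explicit
    finite sum: total, visibly linear, and with values in the span of the
    \<open>b i\<close>.\<close>
  define Z where "Z x = (\<Sum>i<s. scl H3 (of_real (lam i) * ip H1 x (e i)) (b i))" for x
  have Z_mem: "Z x \<in> ocomp H3 (kern B)" for x
    unfolding Z_def by (intro H3.subspace_sum H3.subspace_scale H3.subspace_ocomp b)
  have B_sum: "B (\<Sum>i\<in>I. u i) = (\<Sum>i\<in>I. B (u i))" for I and u :: "nat \<Rightarrow> 'h3"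
    by (induction I rule: infinite_finite_induct) (simp_all add: bounded_op_zero[OF B] bounded_op_add[OF B])
  have BZ: "B (Z x) = Y x" for x
    unfolding Y_def Z_def B_sum bounded_op_scl[OF B]
    by (intro sum.cong refl) (simp add: Bb tensor_def flip: H4.scl_of_real H4.scale_scale)
  have Z_add: "Z (x + x') = Z x + Z x'" for x x'
    by (simp add: Z_def H1.ip_add_left H3.scale_left_distrib sum.distrib distrib_left)
  have Z_scl: "Z (scl H1 c x) = scl H3 c (Z x)" for c x
    by (simp add: Z_def H1.ip_scl_left H3.scale_sum_right mult_ac)
  have X_eq: "X (C x + k) = Some (Z x)" if "x \<in> ocomp H1 (kern C)" "k \<in> ocomp H2 (range C)" for x k
    using H12.mp_inverse_eq[OF C that] H34.mp_inverse_image[OF B Z_mem]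
    by (simp add: X_def map_comp_def BZ)
  show dom: "dom X = dom (mp_inverse H1 H2 C)"
  proof (intro equalityI subsetI)
    fix y assume "y \<in> dom X"
    then show "y \<in> dom (mp_inverse H1 H2 C)"
      by (auto simp: X_def map_comp_def split: option.splits)
  next
    fix y assume "y \<in> dom (mp_inverse H1 H2 C)"
    then obtain x k where "x \<in> ocomp H1 (kern C)" "k \<in> ocomp H2 (range C)" "y = C x + k"
      by (rule H12.dom_mp_inverseE[OF C])
    then show "y \<in> dom X"
      using X_eq by blast
  qed
  \<comment> \<open>Every point of the domain has the form \<open>C x + k\<close> with a known
    value, which reduces linearity, rank and the projection identity to \<open>Z\<close>.\<close>
  have domE: thesis if "y \<in> dom X"
    "\<And>x k. x \<in> ocomp H1 (kern C) \<Longrightarrow> k \<in> ocomp H2 (range C) \<Longrightarrow> y = C x + k \<Longrightarrow> X y = Some (Z x) \<Longrightarrow> thesis"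
    for y thesis
    using that X_eq unfolding dom by (metis H12.dom_mp_inverseE[OF C])
  have X_add: "X (y + y') = Some (the (X y) + the (X y'))" if yy: "y \<in> dom X" "y' \<in> dom X" for y y'
  proof -
    obtain x k where 1: "x \<in> ocomp H1 (kern C)" "k \<in> ocomp H2 (range C)" "y = C x + k" "X y = Some (Z x)"
      using yy(1) by (rule domE)
    obtain x' k' where 2: "x' \<in> ocomp H1 (kern C)" "k' \<in> ocomp H2 (range C)" "y' = C x' + k'"
      "X y' = Some (Z x')"
      using yy(2) by (rule domE)
    have eq: "y + y' = C (x + x') + (k + k')"
      by (simp add: 1(3) 2(3) bounded_op_add[OF C])
    have "X (C (x + x') + (k + k')) = Some (Z x + Z x')"
      using X_eq[of "x + x'" "k + k'"] 1(1,2) 2(1,2)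
      by (simp add: Z_add H1.subspace_add[OF H1.subspace_ocomp] H2.subspace_add[OF H2.subspace_ocomp])
    then show ?thesis
      by (simp only: eq 1(4) 2(4) option.sel)
  qed
  have X_scl: "X (scl H2 c y) = Some (scl H3 c (the (X y)))" if y: "y \<in> dom X" for c y
  proof -
    obtain x k where 1: "x \<in> ocomp H1 (kern C)" "k \<in> ocomp H2 (range C)" "y = C x + k" "X y = Some (Z x)"
      using y by (rule domE)
    have eq: "scl H2 c y = C (scl H1 c x) + scl H2 c k"
      by (simp add: 1(3) bounded_op_scl[OF C] H2.scale_right_distrib)
    have "X (C (scl H1 c x) + scl H2 c k) = Some (scl H3 c (Z x))"
      using X_eq[of "scl H1 c x" "scl H2 c k"] 1(1,2)
      by (simp add: Z_scl H1.subspace_scale[OF H1.subspace_ocomp] H2.subspace_scale[OF H2.subspace_ocomp])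
    then show ?thesis
      by (simp only: eq 1(4) option.sel)
  qed
  have lin: "linear_operator H2 H3 X"
    unfolding linear_operator_def
  proof (intro conjI ballI allI)
    have "0 \<in> dom X"
      using H12.range_subset_dom_mp_inverse[of C 0] by (simp add: dom bounded_op_zero[OF C])
    then show "H2.subspace (dom X)"
      by (intro H2.subspaceI) (blast intro: domI X_add X_scl)+
  qed (use X_add X_scl in auto)
  have "ran X \<subseteq> H3.span (b ` {..<s})"
  proof
    fix z assume "z \<in> ran X"
    then obtain y where "X y = Some z"
      by (auto simp: ran_def)
    then obtain x where x: "z = Z x"
      using domE[of y] by (metis domI option.sel)
    show "z \<in> H3.span (b ` {..<s})"
      unfolding x Z_def by (intro H3.span_sum H3.span_scale H3.span_base imageI)
  qed
  then have rank: "edim H3 (ran X) \<le> enat r"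
    using s card_image_le[of "{..<s}" b] by (intro H3.edim_leI[of "b ` {..<s}"]) auto
  show BXC: "tot B \<circ>\<^sub>m X \<circ>\<^sub>m tot C = tot Y"
  proof
    fix h
    \<comment> \<open>The pseudoinverse of \<open>C\<close> returns only the part \<open>q\<close>
      of \<open>h\<close> orthogonal to ker C. \<open>Y\<close> does not see the difference, as each
      \<open>e i\<close> with \<open>i < s\<close> is orthogonal to \<open>h - q\<close>.\<close>
    define q where "q = proj H1 (ocomp H1 (kern C)) h"
    have q: "q \<in> ocomp H1 (kern C)" and hq: "h - q \<in> ocomp H1 (ocomp H1 (kern C))"
      unfolding q_def by (rule H1.proj_mem H1.diff_proj_mem, rule H1.subspace_ocomp, rule H1.closed_ocomp)+
    have "X (C h) = Some (Z q)"
      using X_eq[OF q, of 0] H2.subspace_0[OF H2.subspace_ocomp]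
      by (simp add: q_def H12.proj_coimage[OF C])
    moreover have "ip H1 q (e i) = ip H1 h (e i)" if "i < s" for i
      using hq e[OF that] by (simp add: ocomp_def H1.ip_diff_left)
    then have "Y q = Y h"
      by (simp add: Y_def tensor_def)
    ultimately show "(tot B \<circ>\<^sub>m X \<circ>\<^sub>m tot C) h = Some (Y h)"
      by (simp add: map_comp_def BZ)
  qed
  have "Y \<in> hilbert_schmidt H1 H4"
    unfolding Y_def by (rule H14.hs_tensor_sum)
  then show "X \<in> feasible_ops H1 H2 H3 H4 B C r"
    using lin dom rank BXC by (auto simp: feasible_ops_def)
  show "X y = (tot (proj H3 (ocomp H3 (kern B))) \<circ>\<^sub>m X \<circ>\<^sub>m tot (proj H2 (closure (range C)))) y"
    if y: "y \<in> dom (mp_inverse H1 H2 C)"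
  proof -
    obtain x k where xk: "x \<in> ocomp H1 (kern C)" "k \<in> ocomp H2 (range C)" "y = C x + k" "X y = Some (Z x)"
      using domE[of y] y dom by blast
    have "proj H2 (closure (range C)) y = C x"
      using xk closure_subset[of "range C"]
      by (intro H2.proj_unique H2.subspace_closure H12.subspace_range C) (auto simp: H2.ocomp_closure)
    moreover have "X (C x) = Some (Z x)"
      using X_eq[OF xk(1), of 0] H2.subspace_0[OF H2.subspace_ocomp] by simp
    moreover have "proj H3 (ocomp H3 (kern B)) (Z x) = Z x"
      by (rule H3.proj_unique[OF H3.subspace_ocomp Z_mem]) (simp add: H3.subspace_0[OF H3.subspace_ocomp])
    ultimately show ?thesis
      using xk(4) by (simp add: map_comp_def)
  qed
qed

lemma residual_eq:
  assumes "tot B \<circ>\<^sub>m X \<circ>\<^sub>m tot C = tot T"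
  shows "residual H1 M B C X = hs_norm H1 (\<lambda>h. M h - T h)"
  unfolding residual_def assms by simp

text \<open>Each \<open>T h\<close> is \<open>B\<close> applied to the value of \<open>X\<close> at
  \<open>C h\<close>, so it depends on \<open>h\<close> through \<open>C h\<close> only.
  \<open>B\<close> carries a finite set spanning the range of \<open>X\<close> to one whose span
  contains the range of \<open>T\<close>.\<close>

lemma feasibleE:
  assumes X: "X \<in> feasible_ops H1 H2 H3 H4 B C r"
  obtains T b where "tot B \<circ>\<^sub>m X \<circ>\<^sub>m tot C = tot T" "T \<in> hilbert_schmidt H1 H4"
    "\<And>h. T (proj H1 (ocomp H1 (kern C)) h) = T h" "range T \<subseteq> range B"
    "finite b" "card b \<le> r" "range T \<subseteq> H4.span b"
proof -
  obtain T where T: "tot B \<circ>\<^sub>m X \<circ>\<^sub>m tot C = tot T" "T \<in> hilbert_schmidt H1 H4"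
    using X by (auto simp: feasible_ops_def)
  obtain b where b: "finite b" "card b \<le> r" "ran X \<subseteq> H3.span b"
    using X by (auto simp: feasible_ops_def elim: H3.edim_leD)
  \<comment> \<open>Equality with a total function says in particular that \<open>X\<close> is
    defined at every \<open>C h\<close>.\<close>
  have TX: "\<exists>z. X (C h) = Some z \<and> T h = B z" for h
    using fun_cong[OF T(1), of h] by (auto simp: map_comp_def split: option.splits)
  have "T (proj H1 (ocomp H1 (kern C)) h) = T h" for h
    using TX[of h] TX[of "proj H1 (ocomp H1 (kern C)) h"] by (auto simp: H12.proj_coimage[OF C])
  moreover have "range T \<subseteq> range B"
    using TX by blast
  moreover have "range T \<subseteq> H4.span (B ` b)"
  proof -
    have "H3.subspace {z. B z \<in> H4.span (B ` b)}"
      by (rule H3.subspaceI) (auto simp: bounded_op_zero[OF B] bounded_op_add[OF B] bounded_op_scl[OF B]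
          intro: H4.span_zero H4.span_add H4.span_scale)
    then have "H3.span b \<subseteq> {z. B z \<in> H4.span (B ` b)}"
      by (intro H3.span_minimal) (auto intro: H4.span_base)
    moreover have "T h \<in> B ` ran X" for h
      using TX[of h] by (auto intro: ranI)
    ultimately have "T h \<in> H4.span (B ` b)" for h
      using b(3) by (metis (mono_tags, lifting) imageE mem_Collect_eq subsetD)
    then show ?thesis
      by (rule image_subsetI)
  qed
  moreover have "finite (B ` b)" "card (B ` b) \<le> r"
    using b card_image_le[OF b(1), of B] by auto
  ultimately show ?thesis
    using that T by blast
qed

end

lemma approximates_exists:
  assumes f: "\<And>i. i < s \<Longrightarrow> f i \<in> closure A"
  shows "\<exists>g. approximates A s f g"
proof -
  \<comment> \<open>The radius \<open>1 / real (Suc n)\<close> is positive even at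
    \<open>n = 0\<close>; being decreasing and below \<open>1 / real n\<close> for n \<ge> 1, it
    gives the condition for all later indices at once.\<close>
  have "\<forall>n i. \<exists>y. i < s \<longrightarrow> y \<in> A \<and> dist y (f i) < 1 / real (Suc n)"
  proof (intro allI)
    fix n i
    show "\<exists>y. i < s \<longrightarrow> y \<in> A \<and> dist y (f i) < 1 / real (Suc n)"
    proof (cases "i < s")
      case True
      then show ?thesis
        using f[OF True] unfolding closure_approachable
        by (meson of_nat_0_less_iff zero_less_Suc zero_less_divide_1_iff)
    qed simp
  qed
  then obtain g where g: "\<And>n i. i < s \<Longrightarrow> g n i \<in> A"
    "\<And>n i. i < s \<Longrightarrow> dist (g n i) (f i) < 1 / real (Suc n)"
    unfolding choice_iff by blast
  have "norm (f i - g m i) < 1 / real n" if "i < s" "1 \<le> n" "n \<le> m" for i m n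
  proof -
    have "norm (f i - g m i) < 1 / real (Suc m)"
      using g(2)[OF that(1), of m] by (simp add: dist_norm norm_minus_commute)
    also have "\<dots> \<le> 1 / real n"
      using that by (intro divide_left_mono) auto
    finally show ?thesis .
  qed
  then show ?thesis
    using g(1) by (intro exI[of _ g]) (auto simp: approximates_def)
qed

section \<open>Lower and upper bounds for the residual\<close>

context low_rank_problem
begin

text \<open>Each \<open>f i\<close> is a multiple of \<open>K (e i)\<close>, hence in the closure of
  ran B. Each \<open>e i\<close> is orthogonal to ker C because \<open>K\<close> vanishes there
  while <K h, f i> = lam i <h, e i> with lam i > 0.\<close>

lemma
  assumes M: "M \<in> hilbert_schmidt H1 H4"
    and K: "K = proj H4 (closure (range B)) \<circ> M \<circ> proj H1 (ocomp H1 (kern C))"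
    and svd: "is_svd H1 H4 K N lam f e" and s: "enat s = min (enat r) N"
  shows svd_left_mem: "i < s \<Longrightarrow> f i \<in> closure (range B)"
    and svd_right_mem: "i < s \<Longrightarrow> e i \<in> ocomp H1 (kern C)"
    and residual_lower_bound: "X \<in> feasible_ops H1 H2 H3 H4 B C r \<Longrightarrow>
      hs_norm H1 (\<lambda>h. M h - (\<Sum>i<s. lam i *\<^sub>R tensor H1 H4 (f i) (e i) h)) \<le> residual H1 M B C X"
proof -
  let ?W = "closure (range B)" and ?V = "ocomp H1 (kern C)"
  have W: "H4.subspace ?W" "closed ?W"
    by (simp_all add: H4.subspace_closure H34.subspace_range[OF B])
  have V: "H1.subspace ?V" "closed ?V"
    by (rule H1.subspace_ocomp, rule H1.closed_ocomp)
  have sN: "enat i < N" if "i < s" for i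
    using that s by (metis enat_ord_simps(2) min_less_iff_conj)
  have pos: "lam i > 0" if "enat i < N" for i
    using svd that by (simp add: is_svd_def)
  show f_mem: "f i \<in> ?W" if "i < s" for i
  proof -
    have "f i = scl H4 (of_real (1 / lam i)) (K (e i))"
      unfolding H4.scl_of_real using H14.svd_image[OF svd sN[OF that]] pos[OF sN[OF that]] by simp
    then show ?thesis
      using H4.subspace_scale[OF W(1)] H4.proj_mem[OF W] by (simp add: K)
  qed
  show e_mem: "e i \<in> ?V" if "i < s" for i
  proof -
    have "ip H1 (e i) h = 0" if h: "C h = 0" for h
    proof -
      have "proj H1 ?V h = 0"
        using h by (intro H1.proj_unique H1.subspace_ocomp H1.subspace_0)
          (auto simp: ocomp_def H1.ip_eq_0_sym)
      moreover have "M 0 = 0" "proj H4 ?W 0 = 0"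
        using M bounded_op_zero H4.proj_bounded_op[OF W] by (auto simp: hilbert_schmidt_def)
      ultimately have "K h = 0"
        by (simp add: K)
      then have "ip H1 h (e i) = 0"
        using H14.svd_coefficient[OF svd sN[OF \<open>i < s\<close>], of h] pos[OF sN[OF \<open>i < s\<close>]] by simp
      then show ?thesis
        using H1.ip_eq_0_sym by blast
    qed
    then show ?thesis
      by (auto simp: ocomp_def)
  qed
  define Y where "Y h = (\<Sum>i<s. lam i *\<^sub>R tensor H1 H4 (f i) (e i) h)" for h
  have Y: "Y \<in> hilbert_schmidt H1 H4"
    unfolding Y_def[abs_def] by (rule H14.hs_tensor_sum)
  \<comment> \<open>For such \<open>R\<close> the compression of M - R is K - R, and what remains is
    M - K whatever \<open>R\<close> is; so errors against \<open>M\<close> and against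
    \<open>K\<close> are ordered alike.\<close>
  have split: "(hs_norm H1 (\<lambda>h. M h - R h))\<^sup>2 =
      (hs_norm H1 (\<lambda>h. K h - R h))\<^sup>2 + (hs_norm H1 (\<lambda>h. M h - K h))\<^sup>2"
    if R: "R \<in> hilbert_schmidt H1 H4" "\<And>h. R (proj H1 ?V h) = R h" "\<And>h. R h \<in> ?W" for R
  proof -
    have sub: "proj H4 ?W (M h - R h) = proj H4 ?W (M h) - R h" for h
    proof -
      have "proj H4 ?W (R h) = R h"
        by (rule H4.proj_unique[OF W(1) R(3)]) (simp add: H4.subspace_0[OF H4.subspace_ocomp])
      then show ?thesis
        by (simp add: bounded_op_diff[OF H4.proj_bounded_op[OF W]])
    qed
    have "proj H4 ?W \<circ> (\<lambda>h. M h - R h) \<circ> proj H1 ?V = (\<lambda>h. K h - R h)"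
    proof
      fix h
      show "(proj H4 ?W \<circ> (\<lambda>h. M h - R h) \<circ> proj H1 ?V) h = K h - R h"
        using sub[of "proj H1 ?V h"] by (simp add: K R(2))
    qed
    then show ?thesis
      using H14.hs_norm_compression(2)[OF H14.hs_minus[OF M R(1)] V W] by simp
  qed
  have Y_mem: "Y h \<in> ?W" for h
    unfolding Y_def tensor_def
    by (intro H4.subspace_sum[OF W(1)])
      (metis H4.scl_of_real H4.subspace_scale W(1) f_mem lessThan_iff)
  have Y_proj: "Y (proj H1 ?V h) = Y h" for h
  proof -
    have "ip H1 (h - proj H1 ?V h) (e i) = 0" if "i < s" for i
      using H1.diff_proj_mem[OF V, of h] e_mem[OF that] by (simp add: ocomp_def)
    then show ?thesis
      by (simp add: Y_def tensor_def H1.ip_diff_left)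
  qed
  show "hs_norm H1 (\<lambda>h. M h - (\<Sum>i<s. lam i *\<^sub>R tensor H1 H4 (f i) (e i) h)) \<le> residual H1 M B C X"
    if X: "X \<in> feasible_ops H1 H2 H3 H4 B C r"
  proof -
    obtain T b where T: "tot B \<circ>\<^sub>m X \<circ>\<^sub>m tot C = tot T" "T \<in> hilbert_schmidt H1 H4"
      "\<And>h. T (proj H1 ?V h) = T h" "range T \<subseteq> range B"
      and b: "finite b" "card b \<le> r" "range T \<subseteq> H4.span b"
      using X by (rule feasibleE) blast
    have TW: "T h \<in> ?W" for h
      using T(4) closure_subset by blast
    have K_hs: "K \<in> hilbert_schmidt H1 H4"
      unfolding K by (rule H14.hs_norm_compression(1)[OF M V W])
    \<comment> \<open>When the minimum is \<open>N\<close>, all terms are kept, which is the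
      alternative \<open>N = enat s\<close>.\<close>
    have "enat s \<le> N" "s = r \<or> N = enat s" "s \<le> r"
      using s by (auto simp: min_def split: if_splits)
    from H14.Eckart_Young_Mirsky[OF K_hs svd this T(2) b]
    have "(hs_norm H1 (\<lambda>h. K h - Y h))\<^sup>2 \<le> (hs_norm H1 (\<lambda>h. K h - T h))\<^sup>2"
      unfolding Y_def by (intro power_mono H14.hs_norm_nonneg)
    then have "(hs_norm H1 (\<lambda>h. M h - Y h))\<^sup>2 \<le> (hs_norm H1 (\<lambda>h. M h - T h))\<^sup>2"
      using split[OF Y Y_proj Y_mem] split[OF T(2,3) TW] by simp
    then show ?thesis
      unfolding residual_eq[OF T(1)] Y_def by (rule power2_le_imp_le[OF _ H14.hs_norm_nonneg])
  qed
qed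

text \<open>The two sums differ by tensors with left factors lam i (f i - g i) and unit right
  factors, so each term costs at most \<open>lam i * \<epsilon>\<close> in the triangle
  inequality.\<close>

lemma residual_upper_bound:
  assumes M: "M \<in> hilbert_schmidt H1 H4" and e: "orthonormal_on H1 {..<s} e"
    and lam: "\<And>i. i < s \<Longrightarrow> lam i \<ge> 0" and g: "\<And>i. i < s \<Longrightarrow> norm (f i - g i) \<le> \<epsilon>"
  shows "hs_norm H1 (\<lambda>h. M h - (\<Sum>i<s. lam i *\<^sub>R tensor H1 H4 (g i) (e i) h))
    \<le> hs_norm H1 (\<lambda>h. M h - (\<Sum>i<s. lam i *\<^sub>R tensor H1 H4 (f i) (e i) h)) + (\<Sum>i<s. lam i) * \<epsilon>"
proof -
  let ?Y = "\<lambda>f h. \<Sum>i<s. lam i *\<^sub>R tensor H1 H4 (f i) (e i) h"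
  let ?d = "\<lambda>i. tensor H1 H4 (lam i *\<^sub>R (f i - g i)) (e i)"
  have "M h - ?Y g h = (M h - ?Y f h) + (\<Sum>i<s. ?d i h)" for h
    by (simp add: tensor_def H4.scl_scaleR H4.scale_right_diff_distrib scaleR_right_diff_distrib
        sum_subtractf)
  then have "hs_norm H1 (\<lambda>h. M h - ?Y g h) \<le>
      hs_norm H1 (\<lambda>h. M h - ?Y f h) + hs_norm H1 (\<lambda>h. \<Sum>i<s. ?d i h)"
    by (simp only:) (intro H14.hs_norm_triangle H14.hs_minus M H14.hs_tensor_sum H14.hs_sum H14.hs_tensor)
  also have "hs_norm H1 (\<lambda>h. \<Sum>i<s. ?d i h) \<le> (\<Sum>i<s. hs_norm H1 (?d i))"
    by (intro H14.hs_norm_sum_le H14.hs_tensor)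
  also have "\<dots> \<le> (\<Sum>i<s. lam i * \<epsilon>)"
    using lam g H1.orthonormal_norm[OF e]
    by (intro sum_mono) (auto simp: H14.hs_norm_tensor intro: mult_left_mono)
  finally show ?thesis
    by (simp add: sum_distrib_right)
qed

end

theorem mainTheorem4:
  fixes H1 :: "('k::rc_field, 'h1::{banach, second_countable_topology}) hilbert"
    and H2 :: "('k, 'h2::{banach, second_countable_topology}) hilbert"
    and H3 :: "('k, 'h3::{banach, second_countable_topology}) hilbert"
    and H4 :: "('k, 'h4::{banach, second_countable_topology}) hilbert"
    and r s :: nat and N :: enat
    and M K :: "'h1 \<Rightarrow> 'h4" and B :: "'h3 \<Rightarrow> 'h4" and C :: "'h1 \<Rightarrow> 'h2"
    and lam :: "nat \<Rightarrow> real" and f :: "nat \<Rightarrow> 'h4" and e :: "nat \<Rightarrow> 'h1"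
  assumes "hilbert_space H1" "hilbert_space H2" "hilbert_space H3" "hilbert_space H4"
    and "M \<in> hilbert_schmidt H1 H4" and "B \<in> bounded_op H3 H4" and "C \<in> bounded_op H1 H2"
    and "K = proj H4 (closure (range B)) \<circ> M \<circ> proj H1 (ocomp H1 (kern C))"
    and "is_svd H1 H4 K N lam f e"
    and "enat s = min (enat r) (edim H4 (range K))"
  shows "(\<exists>g. approximates (range B) s f g) \<and>
    (\<forall>g Y X. approximates (range B) s f g \<longrightarrow>
       (\<forall>n. Y n = (\<lambda>h. \<Sum>i<s. lam i *\<^sub>R tensor H1 H4 (g n i) (e i) h)) \<longrightarrow>
       (\<forall>n. X n = mp_inverse H3 H4 B \<circ>\<^sub>m tot (Y n) \<circ>\<^sub>m mp_inverse H1 H2 C) \<longrightarrow>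
       (\<forall>n\<ge>1. X n \<in> feasible_ops H1 H2 H3 H4 B C r \<and>
          dom (X n) = dom (mp_inverse H1 H2 C) \<and>
          (\<forall>y \<in> dom (mp_inverse H1 H2 C).
             X n y = (tot (proj H3 (ocomp H3 (kern B))) \<circ>\<^sub>m X n \<circ>\<^sub>m
                        tot (proj H2 (closure (range C)))) y)) \<and>
       (\<lambda>n. residual H1 M B C (X n))
         \<longlonglongrightarrow> Inf {residual H1 M B C X' | X'. X' \<in> feasible_ops H1 H2 H3 H4 B C r})"
proof -
  interpret low_rank_problem H1 H2 H3 H4 B C
    using assms(1-4,6,7) by (simp add: low_rank_problem_def low_rank_problem_axioms_def)
  note M = assms(5) and K = assms(8) and svd = assms(9)
  \<comment> \<open>The theorem counts by the rank of \<open>K\<close>, the lemmas by the number of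
    SVD terms.\<close>
  have s: "enat s = min (enat r) N"
    using assms(10) H14.svd_rank[OF svd] by simp
  have sr: "s \<le> r"
    using s by (metis enat_ord_simps(1) min.cobounded1)
  have sN: "enat i < N" if "i < s" for i
    using that s by (metis enat_ord_simps(2) min_less_iff_conj)
  have lam: "lam i \<ge> 0" if "i < s" for i
    using svd sN[OF that] by (auto simp: is_svd_def intro: less_imp_le)
  have e: "orthonormal_on H1 {..<s} e"
    using svd sN by (auto simp: is_svd_def intro: H1.orthonormal_on_subset)
  let ?F = "feasible_ops H1 H2 H3 H4 B C r"
  let ?I = "Inf {residual H1 M B C X' | X'. X' \<in> ?F}"
  let ?L = "hs_norm H1 (\<lambda>h. M h - (\<Sum>i<s. lam i *\<^sub>R tensor H1 H4 (f i) (e i) h))"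
  let ?c = "\<Sum>i<s. lam i"
  have lower: "?L \<le> residual H1 M B C X" if "X \<in> ?F" for X
    by (rule residual_lower_bound[OF M K svd s that])
  have "\<exists>g. approximates (range B) s f g"
    by (rule approximates_exists) (rule svd_left_mem[OF M K svd s])
  moreover have "(\<forall>n\<ge>1. X n \<in> ?F \<and> dom (X n) = dom (mp_inverse H1 H2 C) \<and>
      (\<forall>y \<in> dom (mp_inverse H1 H2 C).
         X n y = (tot (proj H3 (ocomp H3 (kern B))) \<circ>\<^sub>m X n \<circ>\<^sub>m tot (proj H2 (closure (range C)))) y)) \<and>
      (\<lambda>n. residual H1 M B C (X n)) \<longlonglongrightarrow> ?I"
    if g: "approximates (range B) s f g"
      and Y: "\<forall>n. Y n = (\<lambda>h. \<Sum>i<s. lam i *\<^sub>R tensor H1 H4 (g n i) (e i) h)"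
      and X: "\<forall>n. X n = mp_inverse H3 H4 B \<circ>\<^sub>m tot (Y n) \<circ>\<^sub>m mp_inverse H1 H2 C" for g Y X
  proof -
    have gB: "g n i \<in> range B" if "n \<ge> 1" "i < s" for n i
      using g that by (simp add: approximates_def)
    have gf: "norm (f i - g n i) \<le> 1 / real n" if "n \<ge> 1" "i < s" for n i
      using g that by (force simp: approximates_def intro: less_imp_le)
    have appr: "X n \<in> ?F" "dom (X n) = dom (mp_inverse H1 H2 C)"
      "\<forall>y \<in> dom (mp_inverse H1 H2 C).
         X n y = (tot (proj H3 (ocomp H3 (kern B))) \<circ>\<^sub>m X n \<circ>\<^sub>m tot (proj H2 (closure (range C)))) y"
      "tot B \<circ>\<^sub>m X n \<circ>\<^sub>m tot C = tot (Y n)" if n: "n \<ge> 1" for n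
    proof -
      note prems = sr svd_right_mem[OF M K svd s] gB[OF n]
      show "X n \<in> ?F"
        unfolding X[rule_format] Y[rule_format] by (rule approximant(1); fact prems)
      show "dom (X n) = dom (mp_inverse H1 H2 C)"
        unfolding X[rule_format] Y[rule_format] by (rule approximant(2); fact prems)
      show "\<forall>y \<in> dom (mp_inverse H1 H2 C).
         X n y = (tot (proj H3 (ocomp H3 (kern B))) \<circ>\<^sub>m X n \<circ>\<^sub>m tot (proj H2 (closure (range C)))) y"
      proof
        fix y assume "y \<in> dom (mp_inverse H1 H2 C)"
        note prems = prems this
        show "X n y = (tot (proj H3 (ocomp H3 (kern B))) \<circ>\<^sub>m X n \<circ>\<^sub>m tot (proj H2 (closure (range C)))) y"
          unfolding X[rule_format] Y[rule_format] by (rule approximant(3); fact prems)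
      qed
      show "tot B \<circ>\<^sub>m X n \<circ>\<^sub>m tot C = tot (Y n)"
        unfolding X[rule_format] Y[rule_format] by (rule approximant(4); fact prems)
    qed
    have feas: "X n \<in> ?F" if "n \<ge> 1" for n
      by (rule appr(1)[OF that])
    \<comment> \<open>Squeeze: ?L \<le> ?I \<le> residual of \<open>X n\<close> \<le> ?L + ?c / n.
      Feasibility of \<open>X n\<close> also makes the set nonempty, and ?L bounds it below, so that
      its infimum is meaningful.\<close>
    have "norm (residual H1 M B C (X n) - ?I) \<le> ?c * (1 / real n)" if n: "n \<ge> 1" for n
    proof -
      have "?L \<le> ?I"
        using feas[OF n] lower by (intro cInf_greatest) auto
      moreover have "?I \<le> residual H1 M B C (X n)"
        using feas[OF n] lower by (intro cInf_lower bdd_belowI[of _ ?L]) auto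
      moreover have "residual H1 M B C (X n) \<le> ?L + ?c * (1 / real n)"
        unfolding residual_eq[OF appr(4)[OF n]] Y[rule_format]
        by (rule residual_upper_bound[OF M e lam gf[OF n]])
      ultimately show ?thesis
        by simp
    qed
    \<comment> \<open>The conditions on \<open>g\<close> start at index 1, so \<open>X 0\<close> is
      uncontrolled and the estimate is an eventual one.\<close>
    then have "\<forall>\<^sub>F n in sequentially. norm (residual H1 M B C (X n) - ?I) \<le> ?c * (1 / real n)"
      by (rule eventually_sequentiallyI)
    moreover have "(\<lambda>n. ?c * (1 / real n)) \<longlonglongrightarrow> 0"
      by (intro tendsto_mult_right_zero lim_1_over_n)
    ultimately have "(\<lambda>n. residual H1 M B C (X n) - ?I) \<longlonglongrightarrow> 0"
      by (rule Lim_null_comparison)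
    then have "(\<lambda>n. residual H1 M B C (X n)) \<longlonglongrightarrow> ?I"
      by (simp only: LIM_zero_iff)
    then show ?thesis
      using appr(1,2,3) by blast
  qed
  ultimately show ?thesis
    by blast
qed

end
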